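(* Let $P$ be a finite poset with $\mathrm{rk}(P)\le 1$. Then for any $u\le w$ in $P^*$, the interval $[u,w]$ is homotopic to a wedge of $|\mu(u,w)|$ spheres, all of dimension $\mathrm{rk}(w)-\mathrm{rk}(u)-2$.
   Context: $P^*$ is the set of finite words over $P$ with generalized subword order: $u\le w$ iff there are indices $i_1<\dots<i_k$, $k=|u|$, with $u(t)\le_P w(i_t)$ for all $t$; $\mu$ is its Möbius function. The rank of an element $x$ of a finite poset is the length of a longest chain from a minimal element to $x$; $\mathrm{rk}(P)$ is the maximum rank of its elements. For $w\in P^*$, $\mathrm{rk}(w)$ is the rank of $w$ in the interval $[\emptyset,w]$ of $P^*$ ($\emptyset$ the empty word). An interval $[u,w]$ is said to be homotopic to a space if the order complex of the open interval $(u,w)$ (the simplicial complex of all chains in $(u,w)$) is. *)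

theory Defs
  imports "HOL-Analysis.Analysis" "HOL-Library.Sublist"
begin

text \<open>
  A poset is a relation \<open>r\<close> with \<open>Partial_order r\<close>; its underlying set is \<open>Field r\<close>, and
  \<open>(x, y) \<in> r\<close> means \<open>x \<le> y\<close>.
\<close>

section \<open>Generalized subword order\<close>

definition subword_order :: "'a rel \<Rightarrow> 'a list rel" where
  "subword_order r = {(u, w). u \<in> lists (Field r) \<and> w \<in> lists (Field r) \<and>
     (\<exists>i :: nat \<Rightarrow> nat. strict_mono_on {..<length u} i \<and>
        (\<forall>t < length u. i t < length w \<and> (u ! t, w ! i t) \<in> r))}"

lemma list_emb_iff_index:
  "list_emb R u w \<longleftrightarrow>
     (\<exists>i :: nat \<Rightarrow> nat. strict_mono_on {..<length u} i \<and>
        (\<forall>t < length u. i t < length w \<and> R (u ! t) (w ! i t)))"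
proof
  assume "list_emb R u w"
  then show "\<exists>i :: nat \<Rightarrow> nat. strict_mono_on {..<length u} i \<and>
        (\<forall>t < length u. i t < length w \<and> R (u ! t) (w ! i t))"
  proof induction
    case (list_emb_Nil ys)
    show ?case by (auto simp: strict_mono_on_def)
  next
    case (list_emb_Cons xs ys y)
    then obtain i :: "nat \<Rightarrow> nat" where "strict_mono_on {..<length xs} i"
      "\<forall>t < length xs. i t < length ys \<and> R (xs ! t) (ys ! i t)" by blast
    then show ?case
      by (intro exI[of _ "\<lambda>t. Suc (i t)"]) (auto simp: strict_mono_on_def)
  next
    case (list_emb_Cons2 x y xs ys)
    then obtain i :: "nat \<Rightarrow> nat" where "strict_mono_on {..<length xs} i"
      "\<forall>t < length xs. i t < length ys \<and> R (xs ! t) (ys ! i t)" by blast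
    with list_emb_Cons2 show ?case
      by (intro exI[of _ "case_nat 0 (\<lambda>t. Suc (i t))"])
         (auto simp: strict_mono_on_def split: nat.splits)
  qed
next
  assume "\<exists>i :: nat \<Rightarrow> nat. strict_mono_on {..<length u} i \<and>
        (\<forall>t < length u. i t < length w \<and> R (u ! t) (w ! i t))"
  then obtain i :: "nat \<Rightarrow> nat" where "strict_mono_on {..<length u} i"
      "\<forall>t < length u. i t < length w \<and> R (u ! t) (w ! i t)" by blast
  then show "list_emb R u w"
  proof (induction w arbitrary: u i)
    case Nil
    then have "u = []" by auto
    then show ?case by simp
  next
    case (Cons y w)
    show ?case
    proof (cases u)
      case Nil
      then show ?thesis by simp
    next
      case u: (Cons x v)
      have mono: "i s < i t" if "s < t" "t < length u" for s t
        using Cons.prems(1) that by (auto simp: strict_mono_on_def)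
      show ?thesis
      proof (cases "i 0 = 0")
        case True
        have pos: "i (Suc t) > 0" if "t < length v" for t
          using mono[of 0 "Suc t"] that u by auto
        have "list_emb R v w"
        proof (rule Cons.IH[of v "\<lambda>t. i (Suc t) - 1"])
          show "strict_mono_on {..<length v} (\<lambda>t. i (Suc t) - 1)"
            using mono pos u by (auto simp: strict_mono_on_def Suc_le_eq intro!: diff_less_mono)
          show "\<forall>t<length v. i (Suc t) - 1 < length w \<and> R (v ! t) (w ! (i (Suc t) - 1))"
          proof (intro allI impI)
            fix t assume t: "t < length v"
            then have "i (Suc t) < length (y # w) \<and> R (u ! Suc t) ((y # w) ! i (Suc t))"
              using Cons.prems(2) u by auto
            then show "i (Suc t) - 1 < length w \<and> R (v ! t) (w ! (i (Suc t) - 1))"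
              using pos[OF t] u by (cases "i (Suc t)") auto
          qed
        qed
        moreover have "R x y" using Cons.prems(2) True u by auto
        ultimately show ?thesis using u by auto
      next
        case False
        have pos: "i t > 0" if "t < length u" for t
          using mono[of 0 t] that False by (cases t) auto
        have "list_emb R u w"
        proof (rule Cons.IH[of u "\<lambda>t. i t - 1"])
          show "strict_mono_on {..<length u} (\<lambda>t. i t - 1)"
            using mono pos by (auto simp: strict_mono_on_def Suc_le_eq intro!: diff_less_mono)
          show "\<forall>t<length u. i t - 1 < length w \<and> R (u ! t) (w ! (i t - 1))"
          proof (intro allI impI)
            fix t assume t: "t < length u"
            then have "i t < length (y # w) \<and> R (u ! t) ((y # w) ! i t)"
              using Cons.prems(2) by auto
            then show "i t - 1 < length w \<and> R (u ! t) (w ! (i t - 1))"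
              using pos[OF t] by (cases "i t") auto
          qed
        qed
        then show ?thesis by auto
      qed
    qed
  qed
qed

lemma subword_order_iff_list_emb:
  "(u, w) \<in> subword_order r \<longleftrightarrow> u \<in> lists (Field r) \<and> w \<in> lists (Field r) \<and>
     list_emb (\<lambda>x y. (x, y) \<in> r) u w"
  by (simp add: subword_order_def list_emb_iff_index)

lemma list_emb_same_length:
  "list_emb R u w \<Longrightarrow> length u = length w \<Longrightarrow> list_all2 R u w"
  by (induction rule: list_emb.induct) (auto dest: list_emb_length)

lemma Field_subword_order:
  assumes "Partial_order r"
  shows "Field (subword_order r) = lists (Field r)"
proof -
  have "(u, u) \<in> subword_order r" if "u \<in> lists (Field r)" for u
    using that assms unfolding subword_order_iff_list_emb
    by (auto intro!: list_emb_refl simp: partial_order_on_def preorder_on_def refl_on_def)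
  then have "lists (Field r) \<subseteq> Field (subword_order r)"
    by (auto intro: FieldI1)
  moreover have "Field (subword_order r) \<subseteq> lists (Field r)"
    unfolding Field_def[of "subword_order r"] by (auto simp: subword_order_iff_list_emb)
  ultimately show ?thesis by blast
qed

lemma Partial_order_subword_order:
  assumes "Partial_order r"
  shows "Partial_order (subword_order r)"
proof -
  have r: "refl_on (Field r) r" "trans r" "antisym r"
    using assms by (auto simp: partial_order_on_def preorder_on_def)
  have "refl_on (lists (Field r)) (subword_order r)"
    using r(1) by (auto intro!: refl_onI list_emb_refl simp: subword_order_iff_list_emb refl_on_def)
  moreover have "trans (subword_order r)"
    using r(2) by (intro transI)
      (auto simp: subword_order_iff_list_emb dest: transD intro: list_emb_trans[rotated])
  moreover have "antisym (subword_order r)"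
  proof (rule antisymI)
    fix u w assume "(u, w) \<in> subword_order r" "(w, u) \<in> subword_order r"
    then have e: "list_emb (\<lambda>x y. (x, y) \<in> r) u w" "list_emb (\<lambda>x y. (x, y) \<in> r) w u"
      by (auto simp: subword_order_iff_list_emb)
    then have "length u = length w" by (meson le_antisym list_emb_length)
    with e have "list_all2 (\<lambda>x y. (x, y) \<in> r) u w" "list_all2 (\<lambda>x y. (x, y) \<in> r) w u"
      by (auto intro: list_emb_same_length)
    then show "u = w"
      using r(3) by (auto simp: list_all2_conv_all_nth antisym_def intro!: nth_equalityI)
  qed
  moreover have "subword_order r \<subseteq> lists (Field r) \<times> lists (Field r)"
    by (auto simp: subword_order_iff_list_emb)
  ultimately show ?thesis
    using assms by (simp add: Field_subword_order partial_order_on_def preorder_on_def)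
qed


section \<open>Intervals, rank, Moebius function\<close>

definition closed_interval :: "'a rel \<Rightarrow> 'a \<Rightarrow> 'a \<Rightarrow> 'a set" where
  "closed_interval r u w = {x. (u, x) \<in> r \<and> (x, w) \<in> r}"

definition open_interval :: "'a rel \<Rightarrow> 'a \<Rightarrow> 'a \<Rightarrow> 'a set" where
  "open_interval r u w = closed_interval r u w - {u, w}"

lemma finite_closed_interval_subword_order:
  assumes "finite (Field r)"
  shows "finite (closed_interval (subword_order r) u w)"
proof (rule finite_subset)
  show "closed_interval (subword_order r) u w \<subseteq> {x. set x \<subseteq> Field r \<and> length x \<le> length w}"
    by (auto simp: closed_interval_def subword_order_iff_list_emb dest: list_emb_length)
  show "finite {x. set x \<subseteq> Field r \<and> length x \<le> length w}"
    by (rule finite_lists_length_le[OF assms])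
qed

definition minimal_element :: "'a rel \<Rightarrow> 'a \<Rightarrow> bool" where
  "minimal_element r m \<longleftrightarrow> m \<in> Field r \<and> (\<forall>x. (x, m) \<in> r \<longrightarrow> x = m)"

text \<open>The length of a chain is one less than its number of elements.\<close>

definition rank_in :: "'a rel \<Rightarrow> 'a \<Rightarrow> nat" where
  "rank_in r x = Max {card C - 1 | C. C \<in> Chains r \<and> x \<in> C \<and> (\<forall>c\<in>C. (c, x) \<in> r) \<and>
     (\<exists>m\<in>C. minimal_element r m \<and> (\<forall>c\<in>C. (m, c) \<in> r))}"

text \<open>The supremum on \<^typ>\<open>nat\<close> is the maximum, except that the empty poset receives rank 0.\<close>

definition poset_rank :: "'a rel \<Rightarrow> nat" where
  "poset_rank r = (SUP x\<in>Field r. rank_in r x)"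

definition word_rank :: "'a rel \<Rightarrow> 'a list \<Rightarrow> nat" where
  "word_rank r w = rank_in (Restr (subword_order r) (closed_interval (subword_order r) [] w)) w"

text \<open>
  The guard only serves to make the recursion terminate; it holds for all comparable pairs in a
  locally finite poset.
\<close>

function mobius :: "'a rel \<Rightarrow> 'a \<Rightarrow> 'a \<Rightarrow> int" where
  "mobius r u w =
     (if Partial_order r \<and> finite (closed_interval r u w) \<and> (u, w) \<in> r
      then (if u = w then 1 else - (\<Sum>x\<in>closed_interval r u w - {w}. mobius r u x))
      else 0)"
  by auto
termination
proof (relation "Wellfounded.measure (\<lambda>(r, u, w). card (closed_interval r u w))", goal_cases)
  case 1
  show ?case by simp
next
  case (2 r u w x)
  then have r: "refl_on (Field r) r" "trans r" "antisym r"
    by (auto simp: partial_order_on_def preorder_on_def)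
  have x: "(u, x) \<in> r" "(x, w) \<in> r" "x \<noteq> w"
    using 2 by (auto simp: closed_interval_def)
  have "closed_interval r u x \<subseteq> closed_interval r u w"
    using x(2) r(2) by (auto simp: closed_interval_def dest: transD)
  moreover have "w \<in> closed_interval r u w"
    using 2 r(1) by (auto simp: closed_interval_def refl_on_def Field_def)
  moreover have "w \<notin> closed_interval r u x"
    using x r(3) by (auto simp: closed_interval_def dest: antisymD)
  ultimately have "card (closed_interval r u x) < card (closed_interval r u w)"
    using 2 by (intro psubset_card_mono) auto
  then show ?case by simp
qed

declare mobius.simps [simp del]


section \<open>Order complex and its geometric realization\<close>

text \<open>Abstract simplicial complexes are sets of finite sets; the empty simplex is included.\<close>

definition order_complex :: "'a rel \<Rightarrow> 'a set \<Rightarrow> 'a set set" where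
  "order_complex r A = {C. C \<subseteq> A \<and> finite C \<and> C \<in> Chains r}"

text \<open>
  Points are given by barycentric coordinates. For a complex with finitely many simplices, such as
  the order complex of a finite poset, the topology of pointwise convergence used here is the usual
  one; for arbitrary complexes the weak topology would be needed instead.
\<close>

definition geometric_realization :: "'v set set \<Rightarrow> ('v \<Rightarrow> real) topology" where
  "geometric_realization K = subtopology (powertop_real UNIV)
     {x. (\<forall>v. 0 \<le> x v) \<and> {v. x v \<noteq> 0} \<in> K \<and> (\<Sum>v | x v \<noteq> 0. x v) = 1}"


section \<open>Wedges of spheres\<close>

text \<open>
  The wedge of a family of pointed spaces: the quotient of the disjoint sum in which all base points
  \<open>b i\<close> are identified to the single point \<^term>\<open>None\<close>. The wedge of the empty family is a point.
\<close>

definition wedge_map :: "('i \<Rightarrow> 'a) \<Rightarrow> 'i \<times> 'a \<Rightarrow> ('i \<times> 'a) option" where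
  "wedge_map b = (\<lambda>(i, x). if x = b i then None else Some (i, x))"

definition wedge :: "'i set \<Rightarrow> ('i \<Rightarrow> 'a topology) \<Rightarrow> ('i \<Rightarrow> 'a) \<Rightarrow> ('i \<times> 'a) option topology" where
  "wedge I X b = topology (\<lambda>U. U \<subseteq> insert None (wedge_map b ` topspace (sum_topology X I)) \<and>
     openin (sum_topology X I) {p \<in> topspace (sum_topology X I). wedge_map b p \<in> U})"

lemma openin_wedge:
  "openin (wedge I X b) U \<longleftrightarrow>
     U \<subseteq> insert None (wedge_map b ` topspace (sum_topology X I)) \<and>
     openin (sum_topology X I) {p \<in> topspace (sum_topology X I). wedge_map b p \<in> U}"
proof -
  have "istopology (\<lambda>U. U \<subseteq> insert None (wedge_map b ` topspace (sum_topology X I)) \<and>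
     openin (sum_topology X I) {p \<in> topspace (sum_topology X I). wedge_map b p \<in> U})"
    (is "istopology ?L")
    unfolding istopology_def
  proof (intro conjI allI impI)
    fix S T assume "?L S" "?L T"
    moreover have "{p \<in> topspace (sum_topology X I). wedge_map b p \<in> S \<inter> T} =
        {p \<in> topspace (sum_topology X I). wedge_map b p \<in> S} \<inter>
        {p \<in> topspace (sum_topology X I). wedge_map b p \<in> T}" by auto
    ultimately show "S \<inter> T \<subseteq> insert None (wedge_map b ` topspace (sum_topology X I))"
      "openin (sum_topology X I) {p \<in> topspace (sum_topology X I). wedge_map b p \<in> S \<inter> T}"
      by (auto simp del: topspace_sum_topology)
  next
    fix K assume K: "\<forall>S\<in>K. ?L S"
    have "{p \<in> topspace (sum_topology X I). wedge_map b p \<in> \<Union>K} =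
        (\<Union>S\<in>K. {p \<in> topspace (sum_topology X I). wedge_map b p \<in> S})" by auto
    with K show "\<Union>K \<subseteq> insert None (wedge_map b ` topspace (sum_topology X I))"
      "openin (sum_topology X I) {p \<in> topspace (sum_topology X I). wedge_map b p \<in> \<Union>K}"
      by (auto simp del: topspace_sum_topology)
  qed
  then show ?thesis
    by (simp add: wedge_def topology_inverse' del: topspace_sum_topology)
qed

lemma topspace_wedge:
  "topspace (wedge I X b) = insert None (wedge_map b ` topspace (sum_topology X I))"
proof -
  have "{p \<in> topspace (sum_topology X I).
          wedge_map b p \<in> insert None (wedge_map b ` topspace (sum_topology X I))} =
        topspace (sum_topology X I)" by auto
  then have "openin (wedge I X b) (insert None (wedge_map b ` topspace (sum_topology X I)))"
    using openin_topspace[of "sum_topology X I"]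
    by (simp only: openin_wedge subset_refl)
  then show ?thesis
    by (intro antisym openin_subset) (auto simp: openin_wedge topspace_def)
qed

lemma quotient_map_wedge:
  assumes "I \<noteq> {}" "\<And>i. i \<in> I \<Longrightarrow> b i \<in> topspace (X i)"
  shows "quotient_map (sum_topology X I) (wedge I X b) (wedge_map b)"
proof -
  obtain i where i: "i \<in> I" using assms(1) by blast
  then have "wedge_map b (i, b i) \<in> wedge_map b ` topspace (sum_topology X I)"
    using assms(2) by auto
  then have "None \<in> wedge_map b ` topspace (sum_topology X I)"
    by (simp add: wedge_map_def del: topspace_sum_topology)
  then have "wedge_map b ` topspace (sum_topology X I) = topspace (wedge I X b)"
    by (auto simp: topspace_wedge simp del: topspace_sum_topology)
  then show ?thesis
    unfolding quotient_map_def by (auto simp: openin_wedge simp del: topspace_sum_topology)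
qed

definition sphere_basepoint :: "nat \<Rightarrow> real" where
  "sphere_basepoint = (\<lambda>i. if i = 0 then 1 else 0)"

lemma sphere_basepoint_in_nsphere: "sphere_basepoint \<in> topspace (nsphere n)"
  by (simp add: nsphere sphere_basepoint_def if_distrib[of "\<lambda>x. x ^ 2"] cong: if_cong)

text \<open>
  Spheres of negative dimension are empty and have no base point: one or more of them form the empty
  space. As in every dimension, the wedge of no spheres at all is a point. In this way an interval
  \<open>[u, w]\<close> in which \<open>w\<close> covers \<open>u\<close> is a sphere of dimension \<open>-1\<close>, and \<open>[u, u]\<close>, whose
  Moebius number is 1, counts as a sphere of dimension \<open>-2\<close>.
\<close>

definition wedge_of_spheres :: "nat \<Rightarrow> int \<Rightarrow> (nat \<times> (nat \<Rightarrow> real)) option topology" where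
  "wedge_of_spheres k d =
     (if 0 \<le> d then wedge {..<k} (\<lambda>_. nsphere (nat d)) (\<lambda>_. sphere_basepoint)
      else if k = 0 then discrete_topology {None}
      else discrete_topology {})"

end

theory Submission
  imports Defs
begin

text \<open>The delicate point is that the intersections stay in the same family of ideals. A common
  lower bound of \<open>p @ a # s\<close> and an earlier word matters only if it has all of
  \<open>p\<close> in front. Its tail then embeds in \<open>a # s\<close> and also in
  \<open>b # s\<close> or in \<open>a' # s\<close> for another letter \<open>a'\<close> below
  \<open>b\<close>. Rank at most one makes \<open>a\<close> and \<open>a'\<close> minimal, so they
  have no common lower bound and the tail that embeds in both embeds in \<open>s\<close> alone. The
  only extra words are those below \<open>p @ s\<close>, and adding them amounts to moving
  \<open>a\<close> from the suffix to the prefix.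

  The invariant carried through the induction is that all critical simplices have one common size
  \<open>n\<close>. It survives because every reduction of a letter lowers the weight
  \<open>wt\<close> by exactly one: attaching the cone over a complex with critical size
  \<open>n - 1\<close> creates critical simplices of size \<open>n\<close>. As \<open>n\<close> is
  also the largest size of a simplex in the final complex, no critical simplex is a proper face of
  another simplex, so all of them can be postponed to the end.\<close>

text \<open>
  Let \<open>w = p @ s\<close>, and consider the words \<open>y1 @ y2\<close> with \<open>y1\<close> strictly below \<open>p\<close> and \<open>y2\<close> below \<open>s\<close>;
  for empty \<open>s\<close> these are all the words strictly below \<open>w\<close>. Moving a letter \<open>b\<close> from \<open>s\<close> to \<open>p\<close>
  enlarges this ideal by the principal ideals of the words obtained from \<open>w\<close> by reducing \<open>b\<close> (deleting
  it if it is minimal in \<open>P\<close>, and replacing it by some \<open>a < b\<close> otherwise). Since \<open>P\<close> has rank at most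
  one, each of these principal ideals meets the preceding ones in an ideal of the same kind, for a
  word of smaller rank. Attaching cones inductively shows that the order complex of \<open>(u, w)\<close> is built
  by elementary expansions and simplices of the top dimension only: in effect a recursive coatom
  ordering.

  Omitting the top-dimensional simplices leaves a contractible complex. Collapsing it to a point
  turns every top-dimensional simplex into a sphere, and by Philip Hall's theorem the Euler
  characteristic identifies their number as the absolute value of the Moebius function.
\<close>

section \<open>Geometric realizations of finite complexes\<close>

text \<open>Both the void complex \<open>{}\<close> and the complex \<open>{{}}\<close> qualify.
  Their realizations are empty, but they play different parts: the former starts a construction
  sequence, the latter is the order complex of an empty interval.\<close>

definition finite_complex :: "'v set set \<Rightarrow> bool" where
  "finite_complex K \<longleftrightarrow> finite K \<and> (\<forall>\<sigma>\<in>K. finite \<sigma> \<and> Pow \<sigma> \<subseteq> K)"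

lemma finite_complexD:
  assumes "finite_complex K"
  shows "finite K" "\<sigma> \<in> K \<Longrightarrow> finite \<sigma>" "\<sigma> \<in> K \<Longrightarrow> \<rho> \<subseteq> \<sigma> \<Longrightarrow> \<rho> \<in> K"
  using assms by (auto simp: finite_complex_def)

definition realization_points :: "'v set set \<Rightarrow> ('v \<Rightarrow> real) set" where
  "realization_points K = {x. (\<forall>v. 0 \<le> x v) \<and> {v. x v \<noteq> 0} \<in> K \<and> (\<Sum>v | x v \<noteq> 0. x v) = 1}"

lemma geometric_realization_eq: "geometric_realization K = top_of_set (realization_points K)"
  by (simp add: geometric_realization_def realization_points_def euclidean_product_topology)

lemma realization_pointsD:
  assumes "x \<in> realization_points K"
  shows "0 \<le> x v" "{v. x v \<noteq> 0} \<in> K" "\<lbrakk>finite V; {v. x v \<noteq> 0} \<subseteq> V\<rbrakk> \<Longrightarrow> sum x V = 1"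
    "{v. x v \<noteq> 0} \<noteq> {}"
proof -
  have x: "(\<Sum>v | x v \<noteq> 0. x v) = 1"
    using assms by (simp add: realization_points_def)
  show "0 \<le> x v" "{v. x v \<noteq> 0} \<in> K"
    using assms by (auto simp: realization_points_def)
  show "{v. x v \<noteq> 0} \<noteq> {}"
    using x by (metis sum.empty zero_neq_one)
  assume "finite V" "{v. x v \<noteq> 0} \<subseteq> V"
  then have "sum x {v. x v \<noteq> 0} = sum x V"
    by (intro sum.mono_neutral_left) auto
  with x show "sum x V = 1"
    by simp
qed

lemma realization_pointsI:
  assumes "finite V" "\<And>v. 0 \<le> x v" "{v. x v \<noteq> 0} \<subseteq> V" "sum x V = 1" "{v. x v \<noteq> 0} \<in> K"
  shows "x \<in> realization_points K"
proof -
  have "sum x {v. x v \<noteq> 0} = sum x V"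
    using assms by (intro sum.mono_neutral_left) auto
  with assms show ?thesis
    by (simp add: realization_points_def)
qed

lemma realization_points_mono: "C \<subseteq> K \<Longrightarrow> realization_points C \<subseteq> realization_points K"
  by (auto simp: realization_points_def)

lemma continuous_on_coordinate [continuous_intros]:
  "continuous_on S (\<lambda>x :: 'v \<Rightarrow> real. x v)"
  "continuous_on T (\<lambda>z :: 'b::topological_space \<times> ('v \<Rightarrow> real). snd z v)"
  using continuous_on_subset[OF continuous_on_product_coordinates]
    continuous_on_product_then_coordinatewise[OF continuous_on_snd[OF continuous_on_id]] by auto

lemma continuous_on_Min_coordinates [continuous_intros]:
  fixes f :: "'b::topological_space \<Rightarrow> 'v \<Rightarrow> real"
  assumes "finite \<sigma>" "\<sigma> \<noteq> {}" "continuous_on S f"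
  shows "continuous_on S (\<lambda>x. Min (f x ` \<sigma>))"
proof -
  have c: "continuous_on S (\<lambda>x. f x v)" for v
    using assms(3) by (rule continuous_on_product_then_coordinatewise)
  show ?thesis
    using assms(1,2)
  proof (induction rule: finite_ne_induct)
    case (singleton v)
    then show ?case
      using c by simp
  next
    case (insert v \<sigma>)
    then have "continuous_on S (\<lambda>x. min (f x v) (Min (f x ` \<sigma>)))"
      using c by (intro continuous_on_min) auto
    with insert show ?case
      by simp
  qed
qed

lemma closed_simplex_points:
  fixes \<sigma> :: "'v set"
  shows "closed {x :: 'v \<Rightarrow> real. (\<forall>v. 0 \<le> x v) \<and> (\<forall>v. v \<notin> \<sigma> \<longrightarrow> x v = 0) \<and> sum x \<sigma> = 1}"
proof -
  have "closed {x :: 'v \<Rightarrow> real. v \<notin> \<sigma> \<longrightarrow> x v = 0}" for v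
    by (cases "v \<in> \<sigma>") (simp_all add: closed_Collect_eq continuous_intros)
  then show ?thesis
    by (intro closed_Collect_conj closed_Collect_all closed_Collect_le closed_Collect_eq
        continuous_intros) auto
qed

text \<open>The realization is a finite union of closed simplices, hence a closed subset of the cube
  of functions into \<open>{0..1}\<close>. The vertex type may be infinite, so compactness of the
  cube is Tychonoff's theorem.\<close>

lemma compact_realization_points:
  fixes K :: "'v set set"
  assumes K: "finite_complex K"
  shows "compact (realization_points K)"
proof -
  let ?D = "\<lambda>\<sigma>. {x :: 'v \<Rightarrow> real. (\<forall>v. 0 \<le> x v) \<and> (\<forall>v. v \<notin> \<sigma> \<longrightarrow> x v = 0) \<and> sum x \<sigma> = 1}"
  have "realization_points K = (\<Union>\<sigma>\<in>K. ?D \<sigma>)"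
  proof (intro equalityI subsetI)
    fix x assume x: "x \<in> realization_points K"
    then have "x \<in> ?D {v. x v \<noteq> 0}"
      using realization_pointsD[OF x] finite_complexD[OF K] by auto
    then show "x \<in> (\<Union>\<sigma>\<in>K. ?D \<sigma>)"
      using realization_pointsD(2)[OF x] by blast
  next
    fix x assume "x \<in> (\<Union>\<sigma>\<in>K. ?D \<sigma>)"
    then obtain \<sigma> where \<sigma>: "\<sigma> \<in> K" "x \<in> ?D \<sigma>"
      by blast
    then have "{v. x v \<noteq> 0} \<subseteq> \<sigma>"
      by auto
    with \<sigma> show "x \<in> realization_points K"
      using finite_complexD(2,3)[OF K] by (intro realization_pointsI[of \<sigma>]) auto
  qed
  then have "closed (realization_points K)"
    using closed_simplex_points finite_complexD(1)[OF K] by (auto intro!: closed_UN)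
  moreover have "realization_points K \<subseteq> PiE UNIV (\<lambda>_. {0..1})"
  proof
    fix x assume x: "x \<in> realization_points K"
    have "x v \<le> 1" for v
    proof -
      have "x v \<le> sum x (insert v {v. x v \<noteq> 0})"
        using realization_pointsD(1,2)[OF x] finite_complexD(2)[OF K] by (intro member_le_sum) auto
      also have "\<dots> = 1"
        using realization_pointsD(2)[OF x] finite_complexD(2)[OF K]
        by (intro realization_pointsD(3)[OF x]) auto
      finally show ?thesis .
    qed
    then show "x \<in> PiE UNIV (\<lambda>_. {0..1})"
      using realization_pointsD(1)[OF x] by auto
  qed
  moreover have "compact (PiE UNIV (\<lambda>_. {0..1}) :: ('v \<Rightarrow> real) set)"
    using compactin_PiE[of "\<lambda>_. euclideanreal" UNIV "\<lambda>_. {0..1}"]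
    by (simp add: euclidean_product_topology)
  ultimately show ?thesis
    using compact_Int_closed[of "PiE UNIV (\<lambda>_. {0..1})" "realization_points K"]
    by (simp add: Int_absorb1)
qed

text \<open>
  Flowing in the direction from the barycentre of \<open>\<sigma>\<close> to the opposite vertex \<open>v\<close> until some
  coordinate in \<open>\<sigma>\<close> vanishes retracts the simplex \<open>insert v \<sigma>\<close> onto the horn without \<open>\<sigma>\<close>. Outside
  this simplex the minimum over \<open>\<sigma>\<close> is 0, so one formula serves for the whole complex.
\<close>

lemma contractible_elementary_expansion:
  fixes K :: "'v set set"
  assumes K: "finite_complex K" and K': "finite_complex (insert \<sigma> (insert (insert v \<sigma>) K))"
    and \<sigma>: "\<sigma> \<noteq> {}" "v \<notin> \<sigma>" "\<sigma> \<notin> K"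
    and c: "contractible_space (geometric_realization K)"
  shows "contractible_space (geometric_realization (insert \<sigma> (insert (insert v \<sigma>) K)))"
proof -
  define K1 where "K1 = insert \<sigma> (insert (insert v \<sigma>) K)"
  have fin: "finite \<sigma>"
    using K' by (auto simp: finite_complex_def)
  have K1: "finite_complex K1" "insert v \<sigma> \<in> K1"
    using K' by (auto simp: K1_def)
  \<comment> \<open>On the realization of \<open>K1\<close>, \<open>m\<close> is positive exactly on
    the open simplices \<open>\<sigma>\<close> and \<open>insert v \<sigma>\<close>, and 0 on the
    realization of \<open>K\<close>.\<close>
  define m where "m x = Min (x ` \<sigma>)" for x :: "'v \<Rightarrow> real"
  \<comment> \<open>The entry \<open>card \<sigma>\<close> at \<open>v\<close> balances the entries
    -1 over \<open>\<sigma>\<close>, so the flow preserves the coordinate sum.\<close>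
  define d where "d u = (if u \<in> \<sigma> then -1 else if u = v then real (card \<sigma>) else 0)" for u
  define h where "h s x u = x u + s * m x * d u" for s :: real and x :: "'v \<Rightarrow> real" and u
  have sumd: "sum d (insert v \<sigma>) = 0"
  proof -
    have "sum d \<sigma> = - real (card \<sigma>)"
      by (simp add: d_def)
    then show ?thesis
      using fin \<sigma> by (simp add: d_def)
  qed
  have m_cases: "h s x = x \<and> x \<in> realization_points K \<or>
      m x > 0 \<and> {u. x u \<noteq> 0} \<subseteq> insert v \<sigma>" if x: "x \<in> realization_points K1" for x s
  proof -
    have mn: "m x \<ge> 0"
      using realization_pointsD(1)[OF x] fin \<sigma> by (simp add: m_def)
    show ?thesis
    proof (cases "m x = 0")
      case True
      have "m x \<in> x ` \<sigma>"
        unfolding m_def using fin \<sigma> by (intro Min_in) auto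
      with True have "\<not> \<sigma> \<subseteq> {u. x u \<noteq> 0}"
        by auto
      then have "{u. x u \<noteq> 0} \<in> K"
        using realization_pointsD(2)[OF x] by (auto simp: K1_def)
      then have "x \<in> realization_points K"
        using x by (auto simp: realization_points_def)
      with True show ?thesis
        by (auto simp: h_def)
    next
      case False
      with mn have m0: "m x > 0"
        by simp
      have "m x \<le> x u" if "u \<in> \<sigma>" for u
        using that fin by (simp add: m_def)
      with m0 have "\<sigma> \<subseteq> {u. x u \<noteq> 0}"
        by force
      then have "{u. x u \<noteq> 0} \<notin> K"
        using finite_complexD(3)[OF K] \<sigma>(3) by blast
      then show ?thesis
        using realization_pointsD(2)[OF x] m0 by (auto simp: K1_def)
    qed
  qed
  have h_in: "h s x \<in> realization_points K1 \<and> (s = 1 \<longrightarrow> h s x \<in> realization_points K)"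
    if x: "x \<in> realization_points K1" and s: "0 \<le> s" "s \<le> 1" for x s
    using m_cases[OF x]
  proof
    assume "h s x = x \<and> x \<in> realization_points K"
    then show ?thesis
      using x by auto
  next
    assume "m x > 0 \<and> {u. x u \<noteq> 0} \<subseteq> insert v \<sigma>"
    then have m0: "m x > 0" and sup: "{u. x u \<noteq> 0} \<subseteq> insert v \<sigma>"
      by auto
    have le: "m x \<le> x u" if "u \<in> \<sigma>" for u
      using that fin by (simp add: m_def)
    have sup': "{u. h s x u \<noteq> 0} \<subseteq> insert v \<sigma>"
      using sup by (auto simp: h_def d_def)
    have nn: "0 \<le> h s x u" for u
    proof (cases "u \<in> \<sigma>")
      case True
      have "s * m x \<le> m x"
        using m0 s by (simp add: mult_left_le_one_le)
      then show ?thesis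
        using le[OF True] True by (simp add: h_def d_def)
    next
      case False
      then show ?thesis
        using realization_pointsD(1)[OF x] m0 s by (simp add: h_def d_def)
    qed
    have sum1: "sum (h s x) (insert v \<sigma>) = 1"
    proof -
      have "sum (h s x) (insert v \<sigma>) = sum x (insert v \<sigma>) + s * m x * sum d (insert v \<sigma>)"
        unfolding h_def by (simp add: sum.distrib sum_distrib_left)
      then show ?thesis
        using sumd realization_pointsD(3)[OF x _ sup] fin by simp
    qed
    have in1: "{u. h s x u \<noteq> 0} \<in> K1"
      using sup' K1 finite_complexD(3) by blast
    \<comment> \<open>At time 1 every coordinate over \<open>\<sigma>\<close> has lost
      \<open>m x\<close>, so the smallest one has become 0.\<close>
    have "{u. h s x u \<noteq> 0} \<in> K" if "s = 1"
    proof -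
      have "m x \<in> x ` \<sigma>"
        unfolding m_def using fin \<sigma> by (intro Min_in) auto
      then obtain u where "u \<in> \<sigma>" "m x = x u"
        by auto
      then have "u \<in> \<sigma>" "h s x u = 0"
        using that by (auto simp: h_def d_def)
      then have "\<not> \<sigma> \<subseteq> {u. h s x u \<noteq> 0}"
        by auto
      then show ?thesis
        using in1 by (auto simp: K1_def)
    qed
    then show ?thesis
      using fin nn sup' sum1 in1
      by (auto intro!: realization_pointsI[of "insert v \<sigma>"])
  qed
  have h0: "h 0 x = x" for x
    by (auto simp: h_def)
  have h1: "h 1 x = x" if x: "x \<in> realization_points K" for x
  proof -
    have xK1: "x \<in> realization_points K1"
      using x realization_points_mono[of K K1] by (auto simp: K1_def)
    have "m x = 0"
    proof (rule ccontr)
      assume "m x \<noteq> 0"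
      have "m x \<ge> 0"
        using realization_pointsD(1)[OF x] fin \<sigma> by (simp add: m_def)
      have "\<And>u. u \<in> \<sigma> \<Longrightarrow> m x \<le> x u"
        using fin by (simp add: m_def)
      with \<open>m x \<noteq> 0\<close> \<open>m x \<ge> 0\<close> have "\<sigma> \<subseteq> {u. x u \<noteq> 0}"
        by force
      then show False
        using finite_complexD(3)[OF K] realization_pointsD(2)[OF x] \<sigma>(3) by blast
    qed
    then show ?thesis
      by (auto simp: h_def)
  qed
  have cont: "continuous_on S (\<lambda>z. h (fst z) (snd z))" for S
    unfolding h_def m_def using fin \<sigma>
    by (intro continuous_on_coordinatewise_then_product) (auto intro!: continuous_intros)
  have hom: "homotopic_with (\<lambda>x. True) (geometric_realization K1) (geometric_realization K1) id (h 1)"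
    unfolding geometric_realization_eq
    by (subst homotopic_with, simp, rule exI[of _ "\<lambda>z. h (fst z) (snd z)"])
       (use cont h_in h0 in auto)
  have "continuous_map (geometric_realization K1) (geometric_realization K) (h 1)"
  proof -
    have "continuous_on (realization_points K1) ((\<lambda>z. h (fst z) (snd z)) \<circ> Pair 1)"
      by (intro continuous_on_compose continuous_intros cont)
    then have "continuous_on (realization_points K1) (h 1)"
      by (simp add: o_def)
    then show ?thesis
      unfolding geometric_realization_eq using h_in[of _ 1] by auto
  qed
  then have "retraction_maps (geometric_realization K1) (geometric_realization K) (h 1) id"
    using h1 realization_points_mono[of K K1] K1_def
    by (auto simp: retraction_maps_def geometric_realization_eq subset_iff)
  then have "geometric_realization K1 homotopy_equivalent_space geometric_realization K"
    using deformation_retract_imp_homotopy_equivalent_space hom homotopic_with_symD by blast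
  then show ?thesis
    using c homotopy_equivalent_space_contractibility unfolding K1_def by blast
qed

lemma contractible_realization_vertex:
  fixes v :: 'v
  shows "contractible_space (geometric_realization {{}, {v}})"
proof (rule contractible_space_subset_singleton)
  show "topspace (geometric_realization {{}, {v}}) \<subseteq> {\<lambda>u. if u = v then 1 else 0}"
  proof
    fix x assume "x \<in> topspace (geometric_realization {{}, {v}})"
    then have x: "x \<in> realization_points {{}, {v}}"
      by (simp add: geometric_realization_eq)
    then have s: "{u. x u \<noteq> 0} = {v}"
      using realization_pointsD(2,4)[OF x] by auto
    then have "sum x {v} = 1"
      by (intro realization_pointsD(3)[OF x]) auto
    moreover have "x u = 0" if "u \<noteq> v" for u
      using s that by blast
    ultimately show "x \<in> {\<lambda>u. if u = v then 1 else 0}"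
      by auto
  qed
qed

section \<open>Collapsing a contractible subspace\<close>

lemma compact_to_Hausdorff_quotient_map:
  assumes "compact_space X" "Hausdorff_space Y" "continuous_map X Y f"
    "f ` topspace X = topspace Y"
  shows "quotient_map X Y f"
  using assms
  by (simp add: continuous_closed_imp_quotient_map continuous_imp_closed_map_gen
      Hausdorff_imp_kc_space)

text \<open>The classical argument that collapsing a contractible subspace \<open>A\<close> with the
  homotopy extension property is a homotopy equivalence. The map \<open>h\<close> is what that
  property provides: an extension of a contraction of \<open>A\<close> to all of \<open>X\<close>.
  The quotient is described only through the fibres of \<open>q\<close>.\<close>

lemma homotopy_equivalent_collapse:
  assumes X: "compact_space X" and W: "Hausdorff_space W"
    and q: "continuous_map X W q" "q ` topspace X = topspace W"
    and q_eq: "\<And>x y. \<lbrakk>x \<in> topspace X; y \<in> topspace X\<rbrakk> \<Longrightarrow> q x = q y \<longleftrightarrow> x = y \<or> x \<in> A \<and> y \<in> A"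
    and h: "continuous_map (prod_topology (top_of_set {0..1::real}) X) X h"
    and h0: "\<And>x. x \<in> topspace X \<Longrightarrow> h (0, x) = x"
    and h1: "\<And>x. x \<in> A \<Longrightarrow> h (1, x) = c"
    and hA: "\<And>s x. \<lbrakk>s \<in> {0..1}; x \<in> A\<rbrakk> \<Longrightarrow> h (s, x) \<in> A"
  shows "X homotopy_equivalent_space W"
proof -
  let ?I = "top_of_set {0..1::real}"
  have hX: "h (s, x) \<in> topspace X" if "s \<in> {0..1}" "x \<in> topspace X" for s x
    using that h by (auto simp: continuous_map_def)
  have quo: "quotient_map X W q"
    by (rule compact_to_Hausdorff_quotient_map[OF X W q])
  \<comment> \<open>An arbitrary section of \<open>q\<close>, in general not continuous. The maps
    \<open>g\<close> and \<open>G\<close> do not depend on the choice: \<open>h (1, x)\<close> is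
    constant for \<open>x\<close> in \<open>A\<close>, and \<open>h\<close> keeps \<open>A\<close>
    inside \<open>A\<close> at all times.\<close>
  define p where "p y = (SOME x. x \<in> topspace X \<and> q x = y)" for y
  have p: "p y \<in> topspace X \<and> q (p y) = y" if "y \<in> topspace W" for y
  proof -
    have "\<exists>x. x \<in> topspace X \<and> q x = y"
      using that unfolding q(2)[symmetric] by blast
    then show ?thesis
      unfolding p_def by (rule someI_ex)
  qed
  have qW: "q x \<in> topspace W" if "x \<in> topspace X" for x
    using that q(2) by blast
  define g where "g y = h (1, p y)" for y
  have gq: "g (q x) = h (1, x)" if "x \<in> topspace X" for x
    using p[OF qW[OF that]] q_eq that h1 unfolding g_def by metis
  define G where "G = (\<lambda>(s, y). q (h (s, p y)))"
  have Gq: "G (s, q x) = q (h (s, x))" if "x \<in> topspace X" "s \<in> {0..1}" for s x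
  proof -
    have "p (q x) = x \<or> p (q x) \<in> A \<and> x \<in> A"
      using p[OF qW[OF that(1)]] q_eq that(1) by metis
    then have "h (s, p (q x)) = h (s, x) \<or> h (s, p (q x)) \<in> A \<and> h (s, x) \<in> A"
      using hA that(2) by auto
    moreover have "h (s, p (q x)) \<in> topspace X" "h (s, x) \<in> topspace X"
      using p[OF qW[OF that(1)]] hX that by auto
    ultimately have "q (h (s, p (q x))) = q (h (s, x))"
      using q_eq by metis
    then show ?thesis
      by (simp add: G_def)
  qed
  have h1c: "continuous_map X X (\<lambda>x. h (1, x))"
    using continuous_map_o_Pair[OF h, of 1] by (simp add: o_def)
  have g: "continuous_map W X g"
  proof (rule continuous_compose_quotient_map[OF quo])
    show "continuous_map X X (g \<circ> q)"
      using h1c by (rule continuous_map_eq) (simp add: gq)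
  qed
  \<comment> \<open>To descend a homotopy, the product of \<open>q\<close> with the interval must
    again be a quotient map; compactness of the source and the Hausdorff property of the target give
    this directly.\<close>
  have quo2: "quotient_map (prod_topology ?I X) (prod_topology ?I W) (\<lambda>(s, x). (s, q x))"
  proof (rule compact_to_Hausdorff_quotient_map)
    show "compact_space (prod_topology ?I X)"
      using X by (simp add: compact_space_prod_topology compact_space_subtopology)
    show "Hausdorff_space (prod_topology ?I W)"
      using W by (simp add: Hausdorff_space_prod_topology Hausdorff_space_subtopology)
    show "continuous_map (prod_topology ?I X) (prod_topology ?I W) (\<lambda>(s, x). (s, q x))"
      using q(1) by (simp add: continuous_map_prod_top)
    show "(\<lambda>(s, x). (s, q x)) ` topspace (prod_topology ?I X) = topspace (prod_topology ?I W)"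
      using q(2) by force
  qed
  have G: "continuous_map (prod_topology ?I W) W G"
  proof (rule continuous_compose_quotient_map[OF quo2])
    have "continuous_map (prod_topology ?I X) W (q \<circ> h)"
      using h q(1) by (rule continuous_map_compose)
    then show "continuous_map (prod_topology ?I X) W (G \<circ> (\<lambda>(s, x). (s, q x)))"
      by (rule continuous_map_eq) (auto simp: Gq)
  qed
  have "homotopic_with (\<lambda>x. True) X X id (g \<circ> q)"
    by (subst homotopic_with, simp, rule exI[of _ h]) (use h h0 gq in auto)
  moreover have "homotopic_with (\<lambda>x. True) W W id (q \<circ> g)"
    by (subst homotopic_with, simp, rule exI[of _ G]) (use G p h0 in \<open>auto simp: G_def g_def\<close>)
  ultimately show ?thesis
    using q(1) g unfolding homotopy_equivalent_space_def by (metis homotopic_with_symD)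
qed

section \<open>Wedges\<close>

lemma continuous_map_from_sum_topology:
  assumes "\<And>i. i \<in> I \<Longrightarrow> continuous_map (X i) Y (\<lambda>x. g (i, x))"
  shows "continuous_map (sum_topology X I) Y g"
  unfolding continuous_map_def
proof (intro conjI allI impI)
  show "g \<in> topspace (sum_topology X I) \<rightarrow> topspace Y"
    using assms by (fastforce simp: continuous_map_def)
  fix U assume U: "openin Y U"
  have "openin (X i) {x \<in> topspace (X i). g (i, x) \<in> U}" if "i \<in> I" for i
    using assms[OF that] U by (rule openin_continuous_map_preimage)
  then show "openin (sum_topology X I) {p \<in> topspace (sum_topology X I). g p \<in> U}"
    by (auto simp: openin_sum_topology)
qed

lemma continuous_map_wedge_inclusion:
  assumes "i \<in> I" "\<And>j. j \<in> I \<Longrightarrow> b j \<in> topspace (X j)"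
  shows "continuous_map (X i) (wedge I X b) (\<lambda>x. wedge_map b (i, x))"
proof -
  have "quotient_map (sum_topology X I) (wedge I X b) (wedge_map b)"
    using assms by (intro quotient_map_wedge) auto
  then have "continuous_map (X i) (wedge I X b) (wedge_map b \<circ> (\<lambda>x. (i, x)))"
    using assms(1) by (intro continuous_map_compose[OF continuous_map_component_injection]
        quotient_imp_continuous_map) auto
  then show ?thesis
    by (simp add: o_def)
qed

text \<open>Sending all summands but one to the base point gives continuous maps
  \<open>\<pi> i\<close> from the wedge to its summands. Together they separate points, so disjoint
  open sets can be pulled back from a summand.\<close>

lemma Hausdorff_space_wedge:
  assumes H: "\<And>i. i \<in> I \<Longrightarrow> Hausdorff_space (X i)" and b: "\<And>i. i \<in> I \<Longrightarrow> b i \<in> topspace (X i)"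
  shows "Hausdorff_space (wedge I X b)"
proof (cases "I = {}")
  case True
  then show ?thesis
    by (auto simp: Hausdorff_space_def topspace_wedge)
next
  case False
  then have quo: "quotient_map (sum_topology X I) (wedge I X b) (wedge_map b)"
    using b by (rule quotient_map_wedge)
  define \<pi> where "\<pi> i w = (case w of None \<Rightarrow> b i | Some (j, x) \<Rightarrow> if j = i then x else b i)" for i w
  have \<pi>: "continuous_map (wedge I X b) (X i) (\<pi> i)" if i: "i \<in> I" for i
  proof (rule continuous_compose_quotient_map[OF quo])
    have *: "(\<lambda>x. (\<pi> i \<circ> wedge_map b) (j, x)) = (if j = i then (\<lambda>x. x) else (\<lambda>x. b i))" for j
      by (auto simp: \<pi>_def wedge_map_def fun_eq_iff)
    show "continuous_map (sum_topology X I) (X i) (\<pi> i \<circ> wedge_map b)"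
    proof (rule continuous_map_from_sum_topology)
      fix j assume "j \<in> I"
      show "continuous_map (X j) (X i) (\<lambda>x. (\<pi> i \<circ> wedge_map b) (j, x))"
        unfolding * using b[OF i] by simp
    qed
  qed
  show ?thesis
    unfolding Hausdorff_space_def
  proof (intro allI impI, elim conjE)
    fix x y assume x: "x \<in> topspace (wedge I X b)" and y: "y \<in> topspace (wedge I X b)" and "x \<noteq> y"
    have "\<exists>i\<in>I. \<pi> i x \<noteq> \<pi> i y"
    proof (cases x)
      case None
      with y \<open>x \<noteq> y\<close> show ?thesis
        by (auto simp: topspace_wedge \<pi>_def wedge_map_def split: if_splits)
    next
      case (Some p)
      with x obtain i z where p: "p = (i, z)" "i \<in> I" "z \<noteq> b i"
        by (auto simp: topspace_wedge wedge_map_def split: if_splits)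
      then show ?thesis
        using Some y \<open>x \<noteq> y\<close>
        by (intro bexI[of _ i]) (auto simp: topspace_wedge \<pi>_def wedge_map_def split: if_splits)
    qed
    then obtain i where i: "i \<in> I" "\<pi> i x \<noteq> \<pi> i y"
      by blast
    have "\<pi> i x \<in> topspace (X i)" "\<pi> i y \<in> topspace (X i)"
      using \<pi>[OF i(1)] x y by (auto simp: continuous_map_def)
    then obtain U V where UV: "openin (X i) U" "openin (X i) V" "\<pi> i x \<in> U" "\<pi> i y \<in> V" "disjnt U V"
      using H[OF i(1)] i(2) unfolding Hausdorff_space_def by metis
    show "\<exists>U V. openin (wedge I X b) U \<and> openin (wedge I X b) V \<and> x \<in> U \<and> y \<in> V \<and> disjnt U V"
      using UV x y openin_continuous_map_preimage[OF \<pi>[OF i(1)]]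
      by (intro exI[of _ "{w \<in> topspace (wedge I X b). \<pi> i w \<in> U}"]
          exI[of _ "{w \<in> topspace (wedge I X b). \<pi> i w \<in> V}"]) (auto simp: disjnt_iff)
  qed
qed

lemma Hausdorff_space_nsphere: "Hausdorff_space (nsphere d)"
  unfolding nsphere
  by (intro Hausdorff_space_subtopology) (simp add: Hausdorff_space_product_topology)

section \<open>Collapsing the boundary of a simplex\<close>

definition simplex_points :: "'v set \<Rightarrow> ('v \<Rightarrow> real) set" where
  "simplex_points f = {x. (\<forall>v. 0 \<le> x v) \<and> (\<forall>v. v \<notin> f \<longrightarrow> x v = 0) \<and> sum x f = 1}"

text \<open>
  With vertices \<open>e 0, \<dots>, e d\<close>, the edge coordinates \<open>x (e i) - x (e 0)\<close> divided by the least
  barycentric coordinate \<open>m\<close> identify the open simplex with Euclidean space; this is followed by the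
  inverse stereographic projection, and multiplying through by \<open>m\<close> makes the formula extend to the
  boundary.
\<close>

definition simplex_to_sphere :: "nat \<Rightarrow> (nat \<Rightarrow> 'v) \<Rightarrow> ('v \<Rightarrow> real) \<Rightarrow> nat \<Rightarrow> real" where
  "simplex_to_sphere d e x = (\<lambda>i.
     let m = Min (x ` e ` {..d}); S = (\<Sum>j=1..d. (x (e j) - x (e 0))\<^sup>2)
     in if i = 0 then (S - m\<^sup>2) / (S + m\<^sup>2)
        else if i \<le> d then 2 * m * (x (e i) - x (e 0)) / (S + m\<^sup>2) else 0)"

locale enumerated_simplex =
  fixes d :: nat and e :: "nat \<Rightarrow> 'v" and f :: "'v set"
  assumes bij: "bij_betw e {..d} f"
begin

lemma f_eq: "f = e ` {..d}"
  using bij by (simp add: bij_betw_def)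

lemma fin: "finite f" "f \<noteq> {}"
  by (auto simp: f_eq)

abbreviation "least x \<equiv> Min (x ` f)"
abbreviation "edge x i \<equiv> x (e i) - x (e 0)"
abbreviation "edges_sq x \<equiv> (\<Sum>j=1..d. (edge x j)\<^sup>2)"

lemma simplex_to_sphere:
  "simplex_to_sphere d e x 0 = (edges_sq x - (least x)\<^sup>2) / (edges_sq x + (least x)\<^sup>2)"
  "i \<in> {1..d} \<Longrightarrow> simplex_to_sphere d e x i = 2 * least x * edge x i / (edges_sq x + (least x)\<^sup>2)"
  "i > d \<Longrightarrow> simplex_to_sphere d e x i = 0"
  by (auto simp: simplex_to_sphere_def Let_def f_eq)

lemma least_le: "v \<in> f \<Longrightarrow> least x \<le> x v"
  using fin by simp

lemma least_nonneg: "x \<in> simplex_points f \<Longrightarrow> 0 \<le> least x"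
  using fin by (auto simp: simplex_points_def)

lemma least_attained: obtains i where "i \<le> d" "x (e i) = least x"
proof -
  have "least x \<in> x ` f"
    using fin by (intro Min_in) auto
  then obtain v where "v \<in> f" "least x = x v"
    by blast
  moreover obtain i where "i \<le> d" "v = e i"
    using \<open>v \<in> f\<close> unfolding f_eq by blast
  ultimately have "i \<le> d" "least x = x (e i)"
    by auto
  then show ?thesis
    using that[of i] by simp
qed

text \<open>If both summands vanished, all coordinates over \<open>f\<close> would agree with the
  least one, which is 0, and could not add up to 1.\<close>

lemma denominator_pos:
  assumes "x \<in> simplex_points f"
  shows "0 < edges_sq x + (least x)\<^sup>2"
proof (rule ccontr)
  assume "\<not> ?thesis"
  moreover have "0 \<le> edges_sq x"
    by (intro sum_nonneg) simp
  ultimately have *: "edges_sq x = 0" "least x = 0"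
    by (smt (verit) zero_le_power2 zero_eq_power2)+
  then have "x (e i) = x (e 0)" if "i \<le> d" for i
    using that by (cases "i = 0") (auto simp: sum_nonneg_eq_0_iff)
  moreover obtain i where "i \<le> d" "x (e i) = 0"
    using least_attained[of x] * by metis
  ultimately have "x (e i) = 0" if "i \<le> d" for i
    using that by metis
  then have "sum x f = 0"
    by (intro sum.neutral) (auto simp: f_eq)
  with assms show False
    by (simp add: simplex_points_def)
qed

lemma continuous_on_simplex_to_sphere:
  "continuous_on (simplex_points f) (simplex_to_sphere d e)"
proof (intro continuous_on_coordinatewise_then_product)
  have c: "continuous_on (simplex_points f) least"
    using fin by (intro continuous_on_Min_coordinates continuous_on_id) auto
  have pos: "\<forall>x\<in>simplex_points f. edges_sq x + (least x)\<^sup>2 \<noteq> 0"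
    using denominator_pos by (metis less_irrefl)
  fix i
  consider "i = 0" | "i \<in> {1..d}" | "i > d"
    by fastforce
  then show "continuous_on (simplex_points f) (\<lambda>x. simplex_to_sphere d e x i)"
  proof cases
    case 1
    show ?thesis
      unfolding 1 simplex_to_sphere(1) by (intro continuous_intros c pos)
  next
    case 2
    show ?thesis
      unfolding simplex_to_sphere(2)[OF 2] by (intro continuous_intros c pos)
  next
    case 3
    show ?thesis
      unfolding simplex_to_sphere(3)[OF 3] by (intro continuous_intros)
  qed
qed

text \<open>With \<open>S\<close> for the sum of squares and \<open>m\<close> for the least
  coordinate, this is the identity \<open>(S - m^2)^2 + 4 * m^2 * S = (S + m^2)^2\<close>.\<close>

lemma simplex_to_sphere_in_nsphere:
  assumes x: "x \<in> simplex_points f"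
  shows "simplex_to_sphere d e x \<in> topspace (nsphere d)"
proof -
  define N where "N = edges_sq x + (least x)\<^sup>2"
  have N: "N > 0"
    using denominator_pos[OF x] by (simp add: N_def)
  have "{..d} = insert 0 {1..d}"
    by auto
  then have "(\<Sum>i\<le>d. (simplex_to_sphere d e x i)\<^sup>2) =
      (simplex_to_sphere d e x 0)\<^sup>2 + (\<Sum>i=1..d. (simplex_to_sphere d e x i)\<^sup>2)"
    by simp
  also have "(\<Sum>i=1..d. (simplex_to_sphere d e x i)\<^sup>2) = (\<Sum>i=1..d. (2 * least x / N)\<^sup>2 * (edge x i)\<^sup>2)"
    by (intro sum.cong) (auto simp: simplex_to_sphere(2) N_def power_divide power_mult_distrib)
  also have "\<dots> = (2 * least x / N)\<^sup>2 * edges_sq x"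
    by (simp add: sum_distrib_left)
  also have "(simplex_to_sphere d e x 0)\<^sup>2 + \<dots> =
      ((edges_sq x - (least x)\<^sup>2)\<^sup>2 + 4 * (least x)\<^sup>2 * edges_sq x) / N\<^sup>2"
    by (simp add: simplex_to_sphere(1) N_def power_divide power_mult_distrib add_divide_distrib)
  also have "(edges_sq x - (least x)\<^sup>2)\<^sup>2 + 4 * (least x)\<^sup>2 * edges_sq x = N\<^sup>2"
    unfolding N_def by algebra
  finally show ?thesis
    using N by (simp add: nsphere simplex_to_sphere(3))
qed

lemma simplex_to_sphere_boundary:
  assumes x: "x \<in> simplex_points f" and 0: "least x = 0"
  shows "simplex_to_sphere d e x = sphere_basepoint"
proof
  fix i
  consider "i = 0" | "i \<in> {1..d}" | "i > d"
    by fastforce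
  then show "simplex_to_sphere d e x i = sphere_basepoint i"
    using denominator_pos[OF x] 0
    by cases (auto simp: simplex_to_sphere sphere_basepoint_def)
qed

text \<open>This is the divisor in stereographic projection from \<open>sphere_basepoint\<close>. It
  vanishes only where the least coordinate does, so interior points avoid the base point and their
  edge coordinates can be recovered.\<close>

lemma one_minus_simplex_to_sphere:
  assumes "x \<in> simplex_points f"
  shows "1 - simplex_to_sphere d e x 0 = 2 * (least x)\<^sup>2 / (edges_sq x + (least x)\<^sup>2)"
  using denominator_pos[OF assms] by (simp add: simplex_to_sphere(1) field_simps)

lemma simplex_to_sphere_interior:
  assumes x: "x \<in> simplex_points f" and 0: "least x > 0"
  shows "simplex_to_sphere d e x \<noteq> sphere_basepoint"
proof
  assume "simplex_to_sphere d e x = sphere_basepoint"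
  then have "1 - simplex_to_sphere d e x 0 = 0"
    by (simp add: sphere_basepoint_def)
  then show False
    using one_minus_simplex_to_sphere[OF x] denominator_pos[OF x] 0 by simp
qed

text \<open>Stereographic projection recovers the edge coordinates divided by the least coordinate.
  Hence \<open>x'\<close> equals \<open>c * x + s\<close> on the vertices. Looking at a vertex where
  \<open>x'\<close> is least, and at one where \<open>x\<close> is least, gives
  \<open>s = 0\<close>; the coordinate sums then give \<open>c = 1\<close>.\<close>

lemma simplex_to_sphere_inject:
  assumes x: "x \<in> simplex_points f" "least x > 0" and x': "x' \<in> simplex_points f" "least x' > 0"
    and eq: "simplex_to_sphere d e x = simplex_to_sphere d e x'"
  shows "x = x'"
proof -
  have ratio: "simplex_to_sphere d e x i / (1 - simplex_to_sphere d e x 0) = edge x i / least x"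
    if "i \<in> {1..d}" "x \<in> simplex_points f" "least x > 0" for x i
  proof -
    have "2 * m * y / N / (2 * m\<^sup>2 / N) = y / m" if "0 < N" "0 < m" for m y N :: real
      using that by (simp add: power2_eq_square)
    then show ?thesis
      using denominator_pos[OF that(2)] that(3)
      by (simp add: one_minus_simplex_to_sphere[OF that(2)] simplex_to_sphere(2)[OF that(1)])
  qed
  define c where "c = least x' / least x"
  define s where "s = x' (e 0) - c * x (e 0)"
  have c: "c * least x = least x'"
    using x(2) by (simp add: c_def)
  have edge: "edge x' i = c * edge x i" if "i \<le> d" for i
  proof (cases "i = 0")
    case False
    then have "edge x i / least x = edge x' i / least x'"
      using ratio[of i x] ratio[of i x'] x x' eq that by simp
    then show ?thesis
      using x(2) x'(2) by (simp add: c_def field_simps)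
  qed simp
  have aff: "x' (e i) = c * x (e i) + s" if "i \<le> d" for i
    using edge[OF that] by (simp add: s_def algebra_simps)
  have "s = 0"
  proof (rule antisym)
    obtain i where "i \<le> d" "x' (e i) = least x'"
      by (rule least_attained)
    moreover have "c * least x \<le> c * x (e i)"
      using \<open>i \<le> d\<close> less_imp_le[OF x'(2)] x(2) f_eq unfolding c_def
      by (intro mult_left_mono least_le divide_nonneg_pos) (auto simp del: Min_ge_iff)
    ultimately show "s \<le> 0"
      using aff[of i] c by linarith
  next
    obtain i where "i \<le> d" "x (e i) = least x"
      by (rule least_attained)
    then show "0 \<le> s"
      using aff[of i] c least_le[of "e i" x'] by (simp add: f_eq)
  qed
  then have scale: "x' v = c * x v" for v
    using aff x(1) x'(1) by (cases "v \<in> f") (auto simp: f_eq simplex_points_def)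
  have "sum x' f = c * sum x f"
    by (simp add: scale sum_distrib_left)
  then have "c = 1"
    using x(1) x'(1) by (simp add: simplex_points_def)
  then show ?thesis
    using scale by auto
qed

lemma simplex_to_sphere_surj:
  assumes X: "X \<in> topspace (nsphere d)" "X \<noteq> sphere_basepoint"
  obtains x where "x \<in> simplex_points f" "least x > 0" "simplex_to_sphere d e x = X"
proof -
  have "{..d} = insert 0 {1..d}"
    by auto
  then have X2: "(X 0)\<^sup>2 + (\<Sum>i=1..d. (X i)\<^sup>2) = 1" and Xd: "\<And>i. i > d \<Longrightarrow> X i = 0"
    using X(1) by (auto simp: nsphere)
  have X0: "X 0 \<noteq> 1"
  proof
    assume "X 0 = 1"
    then have "(\<Sum>i=1..d. (X i)\<^sup>2) = 0"
      using X2 by simp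
    then have "X i = 0" if "i \<in> {1..d}" for i
      using that by (simp add: sum_nonneg_eq_0_iff)
    then have "X i = sphere_basepoint i" for i
      using Xd \<open>X 0 = 1\<close> by (cases "i = 0"; cases "i > d") (auto simp: sphere_basepoint_def)
    then show False
      using X(2) by auto
  qed
  \<comment> \<open>The stereographic projection of \<open>X\<close>, with the entry 0 for the
    vertex \<open>e 0\<close> at which the edges start.\<close>
  define z where "z i = (if i = 0 then 0 else X i / (1 - X 0))" for i
  define l where "l = Min (z ` {..d})"
  \<comment> \<open>Edge coordinates determine the barycentric ones up to a common shift. This shift
    makes the least entry 1, so after division by the total \<open>T\<close> the edge coordinates
    are \<open>z i\<close> times the least coordinate \<open>1 / T\<close>.\<close>
  define s where "s i = 1 - l + z i" for i
  define T where "T = (\<Sum>i\<le>d. s i)"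
  define x where "x v = (if v \<in> f then s (the_inv_into {..d} e v) / T else 0)" for v
  have l: "l \<le> z i" if "i \<le> d" for i
    using that by (simp add: l_def)
  have s1: "1 \<le> s i" if "i \<le> d" for i
    using l[OF that] by (simp add: s_def)
  have T: "T > 0"
    unfolding T_def using s1 by (intro sum_pos) (auto intro: less_le_trans[of 0 1])
  have xe: "x (e i) = s i / T" if "i \<le> d" for i
    using that bij by (auto simp: x_def f_eq the_inv_into_f_f bij_betw_def)
  have "sum x f = (\<Sum>i\<le>d. x (e i))"
    using bij by (simp add: sum.reindex_bij_betw)
  also have "\<dots> = 1"
    using T by (simp add: xe T_def flip: sum_divide_distrib)
  finally have "sum x f = 1" .
  moreover have "0 \<le> x v" for v
  proof (cases "v \<in> f")
    case True
    then obtain i where "i \<le> d" "v = e i"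
      by (auto simp: f_eq)
    then show ?thesis
      using xe s1[of i] T by simp
  qed (simp add: x_def)
  ultimately have xs: "x \<in> simplex_points f"
    by (auto simp: simplex_points_def x_def)
  have least: "least x = 1 / T"
  proof (rule Min_eqI)
    show "finite (x ` f)"
      using fin by simp
    show "1 / T \<le> y" if "y \<in> x ` f" for y
      using that xe s1 T by (auto simp: f_eq divide_right_mono)
    have "l \<in> z ` {..d}"
      unfolding l_def by (intro Min_in) auto
    then obtain i where "i \<le> d" "l = z i"
      by auto
    then have "x (e i) = 1 / T"
      by (simp add: xe s_def)
    then show "1 / T \<in> x ` f"
      using \<open>i \<le> d\<close> by (force simp: f_eq)
  qed
  have edge: "edge x i = z i / T" if "i \<le> d" for i
    using that by (simp add: xe s_def z_def diff_divide_distrib add_divide_distrib)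
  have "(\<Sum>i=1..d. (z i)\<^sup>2) = (\<Sum>i=1..d. (X i)\<^sup>2 / (1 - X 0)\<^sup>2)"
    by (intro sum.cong) (auto simp: z_def power_divide)
  also have "\<dots> = (1 - (X 0)\<^sup>2) / (1 - X 0)\<^sup>2"
    using X2 by (simp add: eq_diff_eq flip: sum_divide_distrib)
  also have "\<dots> = (1 + X 0) / (1 - X 0)"
  proof -
    have "1 - (X 0)\<^sup>2 = (1 + X 0) * (1 - X 0)"
      by (simp add: power2_eq_square algebra_simps)
    then show ?thesis
      using X0 by (simp add: power2_eq_square)
  qed
  finally have z2: "(\<Sum>i=1..d. (z i)\<^sup>2) = (1 + X 0) / (1 - X 0)" .
  have "edges_sq x = (\<Sum>i=1..d. (z i)\<^sup>2 / T\<^sup>2)"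
    by (intro sum.cong) (auto simp: edge power_divide)
  also have "\<dots> = (1 + X 0) / (1 - X 0) / T\<^sup>2"
    unfolding z2[symmetric] by (rule sum_divide_distrib[symmetric])
  finally have S: "edges_sq x = (1 + X 0) / (1 - X 0) / T\<^sup>2" .
  have N: "edges_sq x + (least x)\<^sup>2 = 2 / (1 - X 0) / T\<^sup>2"
    unfolding S least using X0 T by (simp add: field_simps)
  have N': "edges_sq x - (least x)\<^sup>2 = 2 * X 0 / (1 - X 0) / T\<^sup>2"
    unfolding S least using X0 T by (simp add: field_simps)
  have "simplex_to_sphere d e x i = X i" for i
  proof -
    consider "i = 0" | "i \<in> {1..d}" | "i > d"
      by fastforce
    then show ?thesis
    proof cases
      case 1
      then show ?thesis
        using X0 T unfolding 1 simplex_to_sphere(1) N N' by simp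
    next
      case 2
      then show ?thesis
        using X0 T unfolding simplex_to_sphere(2)[OF 2] N
        by (simp add: least edge z_def power2_eq_square field_simps)
    next
      case 3
      then show ?thesis
        by (simp add: simplex_to_sphere(3) Xd)
    qed
  qed
  then show ?thesis
    using that[of x] xs least T by auto
qed

end

section \<open>Attaching top-dimensional simplices to a contractible complex\<close>

lemma continuous_on_Min_snd [continuous_intros]:
  "finite f \<Longrightarrow> f \<noteq> {} \<Longrightarrow> continuous_on S (\<lambda>z :: 'b::topological_space \<times> ('v \<Rightarrow> real). Min (snd z ` f))"
  by (intro continuous_on_Min_coordinates continuous_on_snd continuous_on_id) auto

text \<open>The number \<open>n\<close> counts vertices, so the facets have dimension
  \<open>n - 1\<close>. Their equal size makes each of them maximal in \<open>C \<union> F\<close>,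
  with its whole boundary in \<open>C\<close>; \<open>0 < n\<close> keeps the empty simplex out of
  \<open>F\<close>.\<close>

locale attached_facets =
  fixes C F :: "'v set set" and n :: nat
  assumes C: "finite_complex C" and CF: "finite_complex (C \<union> F)" and disj: "C \<inter> F = {}"
    and card_F: "f \<in> F \<Longrightarrow> card f = n" and n: "0 < n"
begin

abbreviation "K \<equiv> C \<union> F"
abbreviation "least f x \<equiv> Min (x ` f)"

lemma finF: "finite F"
  using finite_complexD(1)[OF CF] by simp

lemma facet: assumes "f \<in> F" shows "finite f" "f \<noteq> {}" "card f = n"
  using card_F[OF assms] finite_complexD(2)[OF CF] assms n by auto

lemma facet_maximal:
  assumes "f \<in> F" "\<sigma> \<in> K" "f \<subseteq> \<sigma>"
  shows "\<sigma> = f"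
proof (cases "\<sigma> \<in> F")
  case True
  then show ?thesis
    using facet[of f] facet[of \<sigma>] assms card_subset_eq by metis
next
  case False
  then show ?thesis
    using assms finite_complexD(3)[OF C] disj by auto
qed

lemma proper_face_of_facet:
  assumes "f \<in> F" "\<sigma> \<subset> f"
  shows "\<sigma> \<in> C"
proof -
  have "\<sigma> \<in> K"
    using finite_complexD(3)[OF CF, of f] assms by auto
  moreover have "\<sigma> \<notin> F"
    using facet[OF assms(1)] facet(3)[of \<sigma>] psubset_card_mono[OF _ assms(2)] by auto
  ultimately show ?thesis
    by auto
qed

section \<open>Radial coordinates on the facets\<close>

lemma least_nonneg: "\<lbrakk>x \<in> realization_points K; f \<in> F\<rbrakk> \<Longrightarrow> 0 \<le> least f x"
  using facet[of f] realization_pointsD(1)[of x K] by (simp add: Min_ge_iff)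

lemma least_eq_0_iff:
  assumes x: "x \<in> realization_points K" and f: "f \<in> F"
  shows "least f x = 0 \<longleftrightarrow> {v. x v \<noteq> 0} \<noteq> f"
proof
  assume "least f x = 0"
  moreover have "least f x \<in> x ` f"
    using facet[OF f] by (intro Min_in) auto
  ultimately show "{v. x v \<noteq> 0} \<noteq> f"
    by auto
next
  assume "{v. x v \<noteq> 0} \<noteq> f"
  then have "\<not> f \<subseteq> {v. x v \<noteq> 0}"
    using facet_maximal[OF f realization_pointsD(2)[OF x]] by auto
  then obtain v where "v \<in> f" "x v = 0"
    by auto
  then have "least f x \<le> 0"
    using facet[OF f] by (metis Min_le finite_imageI imageI)
  then show "least f x = 0"
    using least_nonneg[OF x f] by simp
qed

lemma realization_points_C_iff:
  assumes "x \<in> realization_points K"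
  shows "x \<in> realization_points C \<longleftrightarrow> {v. x v \<noteq> 0} \<notin> F"
  using assms disj by (auto simp: realization_points_def)

lemma least_eq_0_on_C: "\<lbrakk>x \<in> realization_points C; f \<in> F\<rbrakk> \<Longrightarrow> least f x = 0"
  using least_eq_0_iff[of x f] realization_points_C_iff[of x] realization_points_mono[of C K] by auto

text \<open>The least of \<open>n\<close> barycentric coordinates is at most \<open>1 / n\<close>,
  so the depth grows from 0 on the boundary of a facet to 1 at its barycentre. For a point of the
  realization at most one summand is nonzero; summing over \<open>F\<close> yields a single
  continuous formula.\<close>

definition depth :: "('v \<Rightarrow> real) \<Rightarrow> real" where
  "depth x = (\<Sum>f\<in>F. real n * least f x)"

text \<open>On a facet, this is the barycentre multiplied by \<open>depth x\<close>. The point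
  \<open>x\<close> is this part plus \<open>1 - depth x\<close> times
  \<open>boundary_part x\<close>, the radial projection of \<open>x\<close> to the boundary, which
  is meaningful away from the barycentre.\<close>

definition inner_part :: "('v \<Rightarrow> real) \<Rightarrow> 'v \<Rightarrow> real" where
  "inner_part x v = (\<Sum>f\<in>F. if v \<in> f then least f x else 0)"

definition boundary_part :: "('v \<Rightarrow> real) \<Rightarrow> 'v \<Rightarrow> real" where
  "boundary_part x v = (x v - inner_part x v) / (1 - depth x)"

text \<open>On a facet this keeps the radial direction and turns depth \<open>t\<close> into
  \<open>(2 * t - s) / (2 - s)\<close>, which stretches the part with \<open>t \<ge> s / 2\<close>
  over the whole facet. The \<open>max\<close> suppresses the summands of all other facets, whose
  least coordinate is 0.\<close>

definition dilate :: "real \<Rightarrow> ('v \<Rightarrow> real) \<Rightarrow> 'v \<Rightarrow> real" where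
  "dilate s x v = (\<Sum>f\<in>F. if v \<in> f then max 0 (2 * real n * least f x - s) / ((2 - s) * real n) else 0)
     + 2 / (2 - s) * (x v - inner_part x v)"

lemma on_C:
  assumes "x \<in> realization_points C"
  shows "depth x = 0" "inner_part x v = 0"
  using least_eq_0_on_C[OF assms] by (simp_all add: depth_def inner_part_def sum.neutral)

lemma on_facet:
  assumes x: "x \<in> realization_points K" and f: "f \<in> F" "{v. x v \<noteq> 0} = f"
    and s: "0 \<le> s"
  shows "depth x = real n * least f x" "inner_part x v = (if v \<in> f then least f x else 0)"
    "dilate s x v = (if v \<in> f then max 0 (2 * real n * least f x - s) / ((2 - s) * real n) else 0)
       + 2 / (2 - s) * (x v - inner_part x v)"
proof -
  have z: "least f' x = 0" if "f' \<in> F" "f' \<noteq> f" for f'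
    using least_eq_0_iff[OF x that(1)] f that by auto
  have *: "(\<Sum>f\<in>F. g f) = g f" if "\<And>f'. f' \<in> F \<Longrightarrow> f' \<noteq> f \<Longrightarrow> g f' = 0" for g :: "'v set \<Rightarrow> real"
    using sum.remove[OF finF f(1), of g] that by simp
  show "depth x = real n * least f x"
    unfolding depth_def by (rule *) (simp add: z)
  show "inner_part x v = (if v \<in> f then least f x else 0)"
    unfolding inner_part_def by (rule *) (simp add: z)
  show "dilate s x v = (if v \<in> f then max 0 (2 * real n * least f x - s) / ((2 - s) * real n) else 0)
       + 2 / (2 - s) * (x v - inner_part x v)"
    unfolding dilate_def using s by (subst *) (auto simp: z)
qed

lemma depth_nonneg: "x \<in> realization_points K \<Longrightarrow> 0 \<le> depth x"
  using least_nonneg by (auto simp: depth_def intro!: sum_nonneg)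

lemma sum_minus_inner:
  assumes x: "x \<in> realization_points K" and f: "f \<in> F" "{v. x v \<noteq> 0} = f"
  shows "(\<Sum>v\<in>f. x v - inner_part x v) = 1 - depth x"
  using realization_pointsD(3)[OF x, of f] facet[OF f(1)] f on_facet(1,2)[OF x f order_refl]
  by (simp add: sum_subtractf)

lemma minus_inner_nonneg:
  assumes x: "x \<in> realization_points K"
  shows "0 \<le> x v - inner_part x v"
proof (cases "{v. x v \<noteq> 0} \<in> F")
  case True
  define f where "f = {v. x v \<noteq> 0}"
  have "least f x \<le> x v" if "v \<in> f"
    using facet True that by (simp add: f_def)
  then show ?thesis
    using on_facet(2)[OF x True refl order_refl] realization_pointsD(1)[OF x] by (auto simp: f_def)
next
  case False
  then show ?thesis
    using on_C(2) realization_points_C_iff[OF x] realization_pointsD(1)[OF x] by simp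
qed

lemma boundary_part_id:
  assumes "x \<in> realization_points C"
  shows "boundary_part x = x"
  using on_C[OF assms] by (auto simp: boundary_part_def)

text \<open>Subtracting the least coordinate makes some coordinate of the facet vanish, so the
  support becomes a proper face and lies in \<open>C\<close>.\<close>

lemma boundary_part_in:
  assumes x: "x \<in> realization_points K" and d: "depth x < 1"
  shows "boundary_part x \<in> realization_points C"
proof (cases "{v. x v \<noteq> 0} \<in> F")
  case True
  define f where "f = {v. x v \<noteq> 0}"
  have f: "f \<in> F" "{v. x v \<noteq> 0} = f"
    using True by (auto simp: f_def)
  note on = on_facet[OF x f]
  have "least f x \<in> x ` f"
    using facet[OF f(1)] by (intro Min_in) auto
  then obtain v0 where v0: "v0 \<in> f" "least f x = x v0"
    by blast
  show ?thesis
  proof (rule realization_pointsI)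
    show "finite f"
      using facet f by auto
    show "0 \<le> boundary_part x v" for v
      using minus_inner_nonneg[OF x] d by (simp add: boundary_part_def)
    show sub: "{v. boundary_part x v \<noteq> 0} \<subseteq> f"
      using on(2)[OF order_refl] f by (auto simp: boundary_part_def)
    show "sum (boundary_part x) f = 1"
      using sum_minus_inner[OF x f] d
      by (simp add: boundary_part_def flip: sum_divide_distrib)
    have "boundary_part x v0 = 0"
      using v0 on(2)[OF order_refl] by (simp add: boundary_part_def)
    then show "{v. boundary_part x v \<noteq> 0} \<in> C"
      using proper_face_of_facet[OF f(1)] sub v0 by blast
  qed
next
  case False
  then show ?thesis
    using realization_points_C_iff[OF x] boundary_part_id by metis
qed

lemma dilate_0:
  assumes x: "x \<in> realization_points K"
  shows "dilate 0 x v = x v"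
proof -
  have "(\<Sum>f\<in>F. if v \<in> f then max 0 (2 * real n * least f x - 0) / ((2 - 0) * real n) else 0) = inner_part x v"
    unfolding inner_part_def using least_nonneg[OF x] n by (intro sum.cong) auto
  then show ?thesis
    unfolding dilate_def by simp
qed

lemma dilate_in:
  assumes x: "x \<in> realization_points K" and s: "0 \<le> s" "s \<le> 1" "s \<le> 2 * depth x"
  shows "dilate s x \<in> realization_points K"
proof (cases "{v. x v \<noteq> 0} \<in> F")
  case True
  define f where "f = {v. x v \<noteq> 0}"
  have f: "f \<in> F" "{v. x v \<noteq> 0} = f"
    using True by (auto simp: f_def)
  note on = on_facet[OF x f s(1)]
  have m: "max 0 (2 * real n * least f x - s) = 2 * real n * least f x - s"
    using s(3) on(1) by simp
  show ?thesis
  proof (rule realization_pointsI)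
    show "finite f"
      using facet f by auto
    have "0 \<le> 2 / (2 - s) * (x v - inner_part x v)" for v
      using minus_inner_nonneg[OF x] s by (intro mult_nonneg_nonneg) auto
    moreover have "0 \<le> max 0 (2 * real n * least f x - s) / ((2 - s) * real n)"
      using s by simp
    ultimately show "0 \<le> dilate s x v" for v
      unfolding on(3) by (intro add_nonneg_nonneg) (simp_all only: if_split order_refl simp_thms)
    show sub: "{v. dilate s x v \<noteq> 0} \<subseteq> f"
    proof (rule subsetI, rule ccontr)
      fix v assume "v \<in> {v. dilate s x v \<noteq> 0}" "v \<notin> f"
      moreover have "x v = 0"
        using f(2) \<open>v \<notin> f\<close> by blast
      ultimately show False
        by (simp add: on(2,3))
    qed
    have "sum (dilate s x) f = (\<Sum>v\<in>f. max 0 (2 * real n * least f x - s) / ((2 - s) * real n)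
        + 2 / (2 - s) * (x v - inner_part x v))"
      by (rule sum.cong[OF refl]) (simp only: on(3) if_True)
    also have "\<dots> = real n * (max 0 (2 * real n * least f x - s) / ((2 - s) * real n))
        + 2 / (2 - s) * (\<Sum>v\<in>f. x v - inner_part x v)"
      unfolding sum.distrib sum_distrib_left by (simp only: sum_constant facet(3)[OF f(1)])
    also have "\<dots> = (2 * real n * least f x - s) / (2 - s) + 2 * (1 - real n * least f x) / (2 - s)"
      unfolding sum_minus_inner[OF x f] m on(1) using n by simp
    also have "\<dots> = 1"
      using s unfolding add_divide_distrib[symmetric] by simp
    finally show "sum (dilate s x) f = 1" .
    show "{v. dilate s x v \<noteq> 0} \<in> K"
      using sub f finite_complexD(3)[OF CF] by blast
  qed
next
  case False
  then have "x \<in> realization_points C"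
    using realization_points_C_iff[OF x] by simp
  then have "s = 0"
    using on_C(1) s by simp
  then have "dilate s x = x"
    using dilate_0[OF x] by auto
  then show ?thesis
    using x by simp
qed

text \<open>At depth \<open>s / 2\<close>, the inner edge of the collar, dilation has just reached
  the boundary. This is the agreement needed to glue the two formulas of the homotopy
  extension.\<close>

lemma dilate_eq_boundary_part:
  assumes x: "x \<in> realization_points K" and "s \<le> 1" and s: "2 * depth x = s"
  shows "dilate s x = boundary_part x"
proof
  fix v
  have "2 * real n * least f x \<le> s" if "f \<in> F" for f
  proof -
    have "real n * least f x \<le> depth x"
      unfolding depth_def using that finF least_nonneg[OF x] by (intro member_le_sum) auto
    with s show ?thesis
      by simp
  qed
  then have "(\<Sum>f\<in>F. if v \<in> f then max 0 (2 * real n * least f x - s) / ((2 - s) * real n) else 0) = 0"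
    by (intro sum.neutral) auto
  moreover have e: "2 - s = 2 * (1 - depth x)"
    using s by simp
  have "2 / (2 * a) * y = y / a" for a y :: real
    by simp
  then have "2 / (2 - s) * y = y / (1 - depth x)" for y
    unfolding e .
  ultimately show "dilate s x v = boundary_part x v"
    unfolding dilate_def boundary_part_def by (simp only: add_0)
qed

lemma continuous_on_depth: "continuous_on S (\<lambda>z. depth (snd z))"
  unfolding depth_def using facet by (intro continuous_on_sum continuous_intros) auto

lemma continuous_on_inner_part: "continuous_on S (\<lambda>z. inner_part (snd z) v)"
  unfolding inner_part_def
proof (intro continuous_on_sum)
  fix f assume "f \<in> F"
  then show "continuous_on S (\<lambda>z. if v \<in> f then least f (snd z) else 0)"
    using facet by (cases "v \<in> f") (auto intro!: continuous_intros)
qed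

lemma continuous_on_dilate:
  assumes "\<And>z. z \<in> S \<Longrightarrow> fst z \<le> 1"
  shows "continuous_on S (\<lambda>z. dilate (fst z) (snd z))"
proof (rule continuous_on_coordinatewise_then_product)
  fix v
  have "continuous_on S (\<lambda>z. if v \<in> f
      then max 0 (2 * real n * least f (snd z) - fst z) / ((2 - fst z) * real n) else 0)" if "f \<in> F" for f
  proof (cases "v \<in> f")
    case True
    have "\<forall>z\<in>S. (2 - fst z) * real n \<noteq> 0"
      using assms n by force
    then have "continuous_on S (\<lambda>z. max 0 (2 * real n * least f (snd z) - fst z) / ((2 - fst z) * real n))"
      using facet[OF that] by (intro continuous_on_divide continuous_on_max continuous_intros) auto
    with True show ?thesis
      by simp
  qed simp
  moreover have "continuous_on S (\<lambda>z. 2 / (2 - fst z) * (snd z v - inner_part (snd z) v))"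
  proof -
    have "\<forall>z\<in>S. 2 - fst z \<noteq> 0"
      using assms by force
    then show ?thesis
      by (intro continuous_on_mult continuous_on_divide continuous_on_diff continuous_on_const
          continuous_on_inner_part continuous_on_coordinate continuous_on_fst continuous_on_id) auto
  qed
  ultimately show "continuous_on S (\<lambda>z. dilate (fst z) (snd z) v)"
    unfolding dilate_def by (intro continuous_on_add continuous_on_sum)
qed

lemma continuous_on_boundary_part:
  assumes "\<And>z. z \<in> S \<Longrightarrow> depth (snd z) \<noteq> 1"
  shows "continuous_on S (\<lambda>z. boundary_part (snd z))"
proof (rule continuous_on_coordinatewise_then_product)
  fix v
  have "\<forall>z\<in>S. 1 - depth (snd z) \<noteq> 0"
    using assms by force
  then show "continuous_on S (\<lambda>z. boundary_part (snd z) v)"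
    unfolding boundary_part_def
    by (intro continuous_on_divide continuous_on_diff continuous_on_const
        continuous_on_inner_part continuous_on_coordinate continuous_on_depth)
qed

text \<open>
  The homotopy extension property of the pair: the collar \<open>depth x \<le> s / 2\<close> is used to carry out the
  given homotopy, while the remaining part of each facet is dilated to the full simplex.
\<close>

lemma homotopy_extension:
  fixes H :: "real \<times> ('v \<Rightarrow> real) \<Rightarrow> 'v \<Rightarrow> real"
  assumes H: "continuous_on ({0..1} \<times> realization_points C) H"
      "\<And>z. z \<in> {0..1} \<times> realization_points C \<Longrightarrow> H z \<in> realization_points C"
    and H0: "\<And>x. x \<in> realization_points C \<Longrightarrow> H (0, x) = x"
  obtains h where
    "continuous_map (prod_topology (top_of_set {0..1}) (geometric_realization K)) (geometric_realization K) h"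
    "\<And>x. x \<in> realization_points K \<Longrightarrow> h (0, x) = x"
    "\<And>s x. \<lbrakk>s \<in> {0..1}; x \<in> realization_points C\<rbrakk> \<Longrightarrow> h (s, x) = H (s, x)"
proof -
  let ?X = "top_of_set ({0..1::real} \<times> realization_points K)"
  let ?A = "{z. z \<in> {0..1::real} \<times> realization_points K \<and> 2 * depth (snd z) \<le> fst z}"
  let ?B = "{z. z \<in> {0..1::real} \<times> realization_points K \<and> fst z \<le> 2 * depth (snd z)}"
  \<comment> \<open>A point of depth \<open>t\<close> is pushed outward, reaches the boundary at
    time \<open>2 * t\<close> if that is at most 1, and follows \<open>H\<close> for the remaining
    time. The collar has depth at most 1/2, so the barycentres, where \<open>boundary_part\<close>
    degenerates, are never in it.\<close>
  define h where "h z = (if 2 * depth (snd z) \<le> fst z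
      then H (fst z - 2 * depth (snd z), boundary_part (snd z)) else dilate (fst z) (snd z))" for z
  have A: "(fst z - 2 * depth (snd z), boundary_part (snd z)) \<in> {0..1} \<times> realization_points C"
    if "z \<in> ?A" for z
  proof -
    obtain s x where z: "z = (s, x)" "0 \<le> s" "s \<le> 1" "x \<in> realization_points K" "2 * depth x \<le> s"
      using \<open>z \<in> ?A\<close> by (cases z) auto
    then show ?thesis
      using boundary_part_in[of x] depth_nonneg[of x] by auto
  qed
  have contA: "continuous_on ?A (\<lambda>z. H (fst z - 2 * depth (snd z), boundary_part (snd z)))"
  proof (rule continuous_on_compose2[OF H(1)])
    have "continuous_on ?A (\<lambda>z. boundary_part (snd z))"
      by (rule continuous_on_boundary_part) auto
    then show "continuous_on ?A (\<lambda>z. (fst z - 2 * depth (snd z), boundary_part (snd z)))"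
      by (intro continuous_on_Pair continuous_on_diff continuous_on_fst continuous_on_id
          continuous_on_mult continuous_on_const continuous_on_depth)
  qed (use A in auto)
  have contB: "continuous_on ?B (\<lambda>z. dilate (fst z) (snd z))"
    by (rule continuous_on_dilate) auto
  have "continuous_map ?X (top_of_set (realization_points K)) h"
    unfolding h_def
  proof (rule continuous_map_cases_le)
    show "continuous_map ?X euclideanreal (\<lambda>z. 2 * depth (snd z))"
      by (simp add: continuous_on_mult_left continuous_on_depth)
    show "continuous_map ?X euclideanreal fst"
      by (simp add: continuous_on_fst continuous_on_id)
    have "continuous_map (top_of_set ?A) (top_of_set (realization_points K))
        (\<lambda>z. H (fst z - 2 * depth (snd z), boundary_part (snd z)))"
      using contA H(2)[OF A] realization_points_mono[of C K] by auto
    moreover have "subtopology ?X {z \<in> topspace ?X. 2 * depth (snd z) \<le> fst z} = top_of_set ?A"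
      by (simp add: subtopology_subtopology) (rule arg_cong[of _ _ top_of_set], auto)
    ultimately show "continuous_map (subtopology ?X {z \<in> topspace ?X. 2 * depth (snd z) \<le> fst z})
        (top_of_set (realization_points K)) (\<lambda>z. H (fst z - 2 * depth (snd z), boundary_part (snd z)))"
      by simp
    have "continuous_map (top_of_set ?B) (top_of_set (realization_points K))
        (\<lambda>z. dilate (fst z) (snd z))"
      using contB dilate_in by auto
    moreover have "subtopology ?X {z \<in> topspace ?X. fst z \<le> 2 * depth (snd z)} = top_of_set ?B"
      by (simp add: subtopology_subtopology) (rule arg_cong[of _ _ top_of_set], auto)
    ultimately show "continuous_map (subtopology ?X {z \<in> topspace ?X. fst z \<le> 2 * depth (snd z)})
        (top_of_set (realization_points K)) (\<lambda>z. dilate (fst z) (snd z))"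
      by simp
    fix z assume "z \<in> topspace ?X" and eq: "2 * depth (snd z) = fst z"
    then obtain s x where z: "z = (s, x)" "0 \<le> s" "s \<le> 1" "x \<in> realization_points K" "2 * depth x = s"
      by (cases z) auto
    then show "H (fst z - 2 * depth (snd z), boundary_part (snd z)) = dilate (fst z) (snd z)"
      using H0[OF boundary_part_in[of x]] dilate_eq_boundary_part[of x s] by simp
  qed
  moreover have "h (0, x) = x" if x: "x \<in> realization_points K" for x
  proof (cases "2 * depth x \<le> 0")
    case True
    then have "depth x = 0"
      using depth_nonneg[OF x] by simp
    then have "boundary_part x = dilate 0 x" "boundary_part x \<in> realization_points C"
      using dilate_eq_boundary_part[OF x, of 0] boundary_part_in[OF x] by auto
    then show ?thesis
      using \<open>depth x = 0\<close> H0 dilate_0[OF x] by (auto simp: h_def)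
  next
    case False
    then show ?thesis
      using dilate_0[OF x] by (auto simp: h_def)
  qed
  moreover have "h (s, x) = H (s, x)" if "s \<in> {0..1}" "x \<in> realization_points C" for s x
    using that on_C(1) boundary_part_id by (simp add: h_def)
  ultimately show ?thesis
    by (intro that[of h]) (simp_all add: geometric_realization_eq)
qed

text \<open>The wedge is the quotient of the realization of \<open>K\<close> by that of
  \<open>C\<close>: the latter goes to the wedge point, and each open facet goes bijectively to a
  sphere without its base point. The assumption \<open>ne\<close> provides a preimage of the wedge
  point, as the empty space also counts as contractible.\<close>

theorem homotopy_equivalent_wedge_attached_facets:
  assumes contr: "contractible_space (geometric_realization C)" and ne: "realization_points C \<noteq> {}"
  shows "geometric_realization K homotopy_equivalent_space
    wedge {..<card F} (\<lambda>_. nsphere (n - 1)) (\<lambda>_. sphere_basepoint)"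
proof -
  define d where "d = n - 1"
  let ?X = "geometric_realization K"
  let ?W = "wedge {..<card F} (\<lambda>_. nsphere d) (\<lambda>_. sphere_basepoint)"
  have topX: "topspace ?X = realization_points K"
    by (simp add: geometric_realization_eq)
  have CK: "realization_points C \<subseteq> realization_points K"
    by (rule realization_points_mono) auto
  obtain idx where idx: "bij_betw idx F {..<card F}"
    using ex_bij_betw_finite_nat[OF finF] by (auto simp: atLeast0LessThan)
  have "\<exists>e. bij_betw e {..d} f" if "f \<in> F" for f
    using facet[OF that] n by (intro finite_same_card_bij) (auto simp: d_def)
  then obtain e where e: "\<And>f. f \<in> F \<Longrightarrow> bij_betw (e f) {..d} f"
    by metis
  have enum: "enumerated_simplex d (e f) f" if "f \<in> F" for f
    using e[OF that] by unfold_locales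
  define \<phi> where "\<phi> f = simplex_to_sphere d (e f)" for f
  define q where "q x = (if {v. x v \<noteq> 0} \<in> F
      then Some (idx {v. x v \<noteq> 0}, \<phi> {v. x v \<noteq> 0} x) else None)" for x
  have simplex: "x \<in> simplex_points f" if "x \<in> realization_points K" "f \<in> F" "{v. x v \<noteq> 0} \<subseteq> f" for x f
    using that realization_pointsD[OF that(1)] facet[OF that(2)] by (auto simp: simplex_points_def)
  have in_K: "x \<in> realization_points K" if "x \<in> simplex_points f" "f \<in> F" for x f
  proof (rule realization_pointsI[of f])
    show sub: "{v. x v \<noteq> 0} \<subseteq> f"
      using that by (auto simp: simplex_points_def)
    then show "{v. x v \<noteq> 0} \<in> K"
      using finite_complexD(3)[OF CF] that(2) by blast
  qed (use that facet in \<open>auto simp: simplex_points_def\<close>)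
  have idx_less: "idx f \<in> {..<card F}" if "f \<in> F" for f
    using idx that by (auto simp: bij_betw_def)
  have q_None: "q x = None \<longleftrightarrow> x \<in> realization_points C" if "x \<in> realization_points K" for x
    using realization_points_C_iff[OF that] by (simp add: q_def)
  have q_simplex: "q x = wedge_map (\<lambda>_. sphere_basepoint) (idx f, \<phi> f x)"
    if "x \<in> realization_points K" "f \<in> F" "{v. x v \<noteq> 0} \<subseteq> f" for x f
  proof -
    interpret enumerated_simplex d "e f" f
      using enum[OF that(2)] .
    note x = simplex[OF that]
    show ?thesis
    proof (cases "{v. x v \<noteq> 0} = f")
      case True
      then have "Min (x ` f) > 0"
        using least_eq_0_iff[OF that(1,2)] least_nonneg[OF x] by simp
      then show ?thesis
        using simplex_to_sphere_interior[OF x] True that by (simp add: q_def wedge_map_def \<phi>_def)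
    next
      case False
      then have "Min (x ` f) = 0"
        using least_eq_0_iff[OF that(1,2)] by simp
      moreover have "{v. x v \<noteq> 0} \<notin> F"
        using facet_maximal[of "{v. x v \<noteq> 0}" f] that False by auto
      ultimately show ?thesis
        using simplex_to_sphere_boundary[OF x] by (simp add: q_def wedge_map_def \<phi>_def)
    qed
  qed
  have cont_q: "continuous_map ?X ?W q"
  proof -
    \<comment> \<open>A finite closed cover along which \<open>q\<close> is pasted:
      \<open>T None\<close> is the realization of \<open>C\<close>, and \<open>T (Some f)\<close> is
      the closed simplex \<open>f\<close>.\<close>
    define T where "T i = (case i of None \<Rightarrow> {x \<in> realization_points K. \<forall>f\<in>F. Min (x ` f) = 0}
      | Some f \<Rightarrow> {x \<in> realization_points K. \<forall>v\<in>\<Union>K - f. x v = 0})" for i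
    define g where "g i x = (case i of None \<Rightarrow> None
      | Some f \<Rightarrow> wedge_map (\<lambda>_. sphere_basepoint :: nat \<Rightarrow> real) (idx f, \<phi> f x))" for i x
    have T_Some: "{v. x v \<noteq> 0} \<subseteq> f" if "x \<in> T (Some f)" for x f
      using that realization_pointsD(2)[of x K] by (auto simp: T_def)
    have T_None: "x \<in> realization_points C" if "x \<in> T None" for x
      using that least_eq_0_iff[of x] realization_points_C_iff[of x] by (auto simp: T_def)
    have T_K: "T i \<subseteq> realization_points K" for i
      by (auto simp: T_def split: option.splits)
    have T_cont: "q x = g i x" if "x \<in> T i" "i \<in> insert None (Some ` F)" for i x
    proof -
      have "x \<in> realization_points K"
        using that(1) T_K by blast
      then show ?thesis
        using q_simplex[of x] q_None[of x] T_Some[of x] T_None[of x] that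
        by (cases i) (auto simp: g_def)
    qed
    show ?thesis
    proof (rule pasting_lemma_closed)
      show "finite (insert None (Some ` F))"
        using finF by simp
      show "closedin ?X (T i)" if "i \<in> insert None (Some ` F)" for i
      proof (cases i)
        case None
        have "closed {x :: 'v \<Rightarrow> real. Min (x ` f) = 0}" if "f \<in> F" for f
          using facet[OF that]
          by (intro closed_Collect_eq continuous_on_Min_coordinates continuous_on_id continuous_on_const) auto
        then have "closed (\<Inter>f\<in>F. {x :: 'v \<Rightarrow> real. Min (x ` f) = 0})"
          by blast
        moreover have "T i = realization_points K \<inter> (\<Inter>f\<in>F. {x. Min (x ` f) = 0})"
          by (auto simp: T_def None)
        ultimately show ?thesis
          by (simp add: geometric_realization_eq closedin_closed_Int)
      next
        case (Some f)
        have "closed (\<Inter>v\<in>\<Union>K - f. {x :: 'v \<Rightarrow> real. x v = 0})"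
          by (intro closed_INT ballI closed_Collect_eq continuous_on_coordinate continuous_on_const)
        moreover have "T i = realization_points K \<inter> (\<Inter>v\<in>\<Union>K - f. {x. x v = 0})"
          by (auto simp: T_def Some)
        ultimately show ?thesis
          by (simp add: geometric_realization_eq closedin_closed_Int)
      qed
      show "continuous_map (subtopology ?X (T i)) ?W (g i)" if "i \<in> insert None (Some ` F)" for i
      proof (cases i)
        case None
        then have "g i = (\<lambda>x. None)"
          by (auto simp: g_def)
        then show ?thesis
          by (simp add: topspace_wedge)
      next
        case (Some f)
        then have f: "f \<in> F"
          using that by auto
        interpret enumerated_simplex d "e f" f
          using enum[OF f] .
        have sub: "subtopology ?X (T i) = top_of_set (T i)"
          using T_K[of i] by (simp add: geometric_realization_eq subtopology_subtopology Int_absorb1)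
        have Ti: "T i \<subseteq> simplex_points f"
          using simplex[OF _ f] T_Some T_K[of i] unfolding Some by blast
        have "continuous_map (top_of_set (T i)) (nsphere d) (\<phi> f)"
          unfolding nsphere continuous_map_in_subtopology \<phi>_def
          using continuous_on_subset[OF continuous_on_simplex_to_sphere Ti]
            simplex_to_sphere_in_nsphere Ti
          by (auto simp: euclidean_product_topology nsphere)
        then have "continuous_map (top_of_set (T i)) ?W
            ((\<lambda>x. wedge_map (\<lambda>_. sphere_basepoint) (idx f, x)) \<circ> \<phi> f)"
          by (rule continuous_map_compose, intro continuous_map_wedge_inclusion)
             (use idx_less[OF f] sphere_basepoint_in_nsphere in auto)
        moreover have "g i = (\<lambda>x. wedge_map (\<lambda>_. sphere_basepoint) (idx f, x)) \<circ> \<phi> f"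
          by (auto simp: g_def Some)
        ultimately show ?thesis
          unfolding sub by simp
      qed
      show "g i x = g j x" if "i \<in> insert None (Some ` F)" "j \<in> insert None (Some ` F)"
        "x \<in> topspace ?X \<inter> T i \<inter> T j" for i j x
        using T_cont that by (metis IntD1 IntD2)
      show "\<exists>j. j \<in> insert None (Some ` F) \<and> x \<in> T j \<and> q x = g j x" if x: "x \<in> topspace ?X" for x
      proof (cases "{v. x v \<noteq> 0} \<in> F")
        case True
        then have "x \<in> T (Some {v. x v \<noteq> 0})"
          using x by (auto simp: T_def topX)
        then show ?thesis
          using T_cont True by blast
      next
        case False
        then have "x \<in> realization_points C"
          using realization_points_C_iff x by (simp add: topX)
        then have "x \<in> T None"
          using least_eq_0_on_C CK by (auto simp: T_def)
        then show ?thesis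
          using T_cont by blast
      qed
    qed
  qed
  have q_image: "q ` topspace ?X = topspace ?W"
  proof (rule antisym)
    show "q ` topspace ?X \<subseteq> topspace ?W"
      using cont_q by (auto simp: continuous_map_def)
    show "topspace ?W \<subseteq> q ` topspace ?X"
    proof
      fix w assume w: "w \<in> topspace ?W"
      show "w \<in> q ` topspace ?X"
      proof (cases w)
        case None
        obtain x where "x \<in> realization_points C"
          using ne by blast
        then show ?thesis
          using q_None[of x] CK None topX by (metis imageI subsetD)
      next
        case (Some p)
        then obtain i z where p: "w = Some (i, z)" "i < card F" "z \<in> topspace (nsphere d)" "z \<noteq> sphere_basepoint"
          using w by (auto simp: topspace_wedge wedge_map_def split: if_splits)
        then obtain f where f: "f \<in> F" "idx f = i"
          using idx by (metis bij_betw_imp_surj_on imageE lessThan_iff)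
        interpret enumerated_simplex d "e f" f
          using enum[OF f(1)] .
        obtain x where x: "x \<in> simplex_points f" "\<phi> f x = z"
          using simplex_to_sphere_surj[OF p(3,4)] unfolding \<phi>_def by metis
        have "{v. x v \<noteq> 0} \<subseteq> f"
          using x(1) by (auto simp: simplex_points_def)
        then have "q x = w"
          using q_simplex[OF in_K[OF x(1) f(1)] f(1)] p f x by (simp add: wedge_map_def)
        then show ?thesis
          using in_K[OF x(1) f(1)] topX by blast
      qed
    qed
  qed
  have q_eq: "q x = q y \<longleftrightarrow> x = y \<or> x \<in> realization_points C \<and> y \<in> realization_points C"
    if x: "x \<in> topspace ?X" and y: "y \<in> topspace ?X" for x y
  proof
    assume eq: "q x = q y"
    show "x = y \<or> x \<in> realization_points C \<and> y \<in> realization_points C"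
    proof (cases "q x")
      case None
      then show ?thesis
        using eq q_None x y topX by metis
    next
      case (Some p)
      define f where "f = {v. x v \<noteq> 0}"
      have f: "f \<in> F" "{v. y v \<noteq> 0} \<in> F" "idx f = idx {v. y v \<noteq> 0}"
        "\<phi> f x = \<phi> {v. y v \<noteq> 0} y"
        using Some eq by (auto simp: q_def f_def split: if_splits)
      then have fy: "{v. y v \<noteq> 0} = f"
        using idx by (metis bij_betw_imp_inj_on inj_onD)
      interpret enumerated_simplex d "e f" f
        using enum[OF f(1)] .
      have xs: "x \<in> simplex_points f" "y \<in> simplex_points f"
        using x y f(1) fy topX by (auto intro!: simplex simp: f_def)
      have "Min (x ` f) > 0" "Min (y ` f) > 0"
        using least_eq_0_iff[of _ f] x y f(1) fy topX least_nonneg xs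
        by (auto simp: f_def order_less_le)
      then show ?thesis
        using simplex_to_sphere_inject[OF xs(1) _ xs(2)] f(4) fy by (simp add: \<phi>_def)
    qed
  next
    assume "x = y \<or> x \<in> realization_points C \<and> y \<in> realization_points C"
    then show "q x = q y"
      using q_None x y topX by metis
  qed
  obtain c where "homotopic_with (\<lambda>x. True) (geometric_realization C) (geometric_realization C) id (\<lambda>x. c)"
    using contr by (auto simp: contractible_space_def)
  then obtain H where "continuous_on ({0..1::real} \<times> realization_points C) H"
      "H \<in> {0..1} \<times> realization_points C \<rightarrow> realization_points C"
      "\<forall>x. H (0, x) = x" "\<forall>x. H (1, x) = c"
    unfolding homotopic_with_def geometric_realization_eq by auto
  then have H: "continuous_on ({0..1} \<times> realization_points C) H"
      "\<And>z. z \<in> {0..1} \<times> realization_points C \<Longrightarrow> H z \<in> realization_points C"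
      "\<And>x. H (0, x) = x" "\<And>x. H (1, x) = c"
    by blast+
  obtain h where h: "continuous_map (prod_topology (top_of_set {0..1}) ?X) ?X h"
    "\<And>x. x \<in> realization_points K \<Longrightarrow> h (0, x) = x"
    "\<And>s x. \<lbrakk>s \<in> {0..1}; x \<in> realization_points C\<rbrakk> \<Longrightarrow> h (s, x) = H (s, x)"
  proof (rule homotopy_extension)
    show "H (0, x) = x" for x
      by (rule H(3))
  qed (use H(1,2) in auto)
  have "?X homotopy_equivalent_space ?W"
  proof (rule homotopy_equivalent_collapse[OF _ _ cont_q q_image q_eq h(1)])
    show "compact_space ?X"
      using compact_realization_points[OF CF]
      by (simp add: geometric_realization_eq compact_space_subtopology)
    show "Hausdorff_space ?W"
      by (intro Hausdorff_space_wedge Hausdorff_space_nsphere sphere_basepoint_in_nsphere)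
    show "h (0, x) = x" if "x \<in> topspace ?X" for x
      using that h(2) topX by simp
    show "h (1, x) = c" if "x \<in> realization_points C" for x
      using that h(3) H(4) by simp
    show "h (s, x) \<in> realization_points C" if "s \<in> {0..1}" "x \<in> realization_points C" for s x
      using that h(3) H(2) by simp
  qed
  then show ?thesis
    by (simp add: d_def)
qed

end

section \<open>Acyclic matchings with critical simplices of one size\<close>

text \<open>
  A discrete Morse function encoded as a construction sequence. The empty simplex takes part, so
  that for positive \<open>n\<close> the first step always pairs it with a vertex.
\<close>

inductive morse :: "nat \<Rightarrow> 'v set set \<Rightarrow> bool" for n where
  empty: "morse n {}"
| pair: "\<lbrakk>morse n K; finite \<sigma>; v \<notin> \<sigma>; \<sigma> \<notin> K; insert v \<sigma> \<notin> K;
    \<And>\<rho>. \<lbrakk>\<rho> \<subset> insert v \<sigma>; \<rho> \<noteq> \<sigma>\<rbrakk> \<Longrightarrow> \<rho> \<in> K\<rbrakk> \<Longrightarrow> morse n (insert \<sigma> (insert (insert v \<sigma>) K))"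
| critical: "\<lbrakk>morse n K; finite \<sigma>; card \<sigma> = n; \<sigma> \<notin> K; \<And>\<rho>. \<rho> \<subset> \<sigma> \<Longrightarrow> \<rho> \<in> K\<rbrakk> \<Longrightarrow> morse n (insert \<sigma> K)"

lemma finite_complex_insert:
  assumes K: "finite_complex K" and \<sigma>: "finite \<sigma>" "\<And>\<rho>. \<rho> \<subset> \<sigma> \<Longrightarrow> \<rho> \<in> K"
  shows "finite_complex (insert \<sigma> K)"
proof -
  have "Pow \<sigma> \<subseteq> insert \<sigma> K"
    using \<sigma>(2) by (metis PowD insertCI psubsetI subsetI)
  then show ?thesis
    using K \<sigma>(1) by (auto simp: finite_complex_def)
qed

lemma finite_complex_insert_pair:
  assumes "finite_complex K" "finite \<sigma>" "v \<notin> \<sigma>"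
    and K: "\<And>\<rho>. \<lbrakk>\<rho> \<subset> insert v \<sigma>; \<rho> \<noteq> \<sigma>\<rbrakk> \<Longrightarrow> \<rho> \<in> K"
  shows "finite_complex (insert \<sigma> (insert (insert v \<sigma>) K))"
proof -
  have "finite_complex (insert \<sigma> K)"
    using assms by (intro finite_complex_insert) auto
  then have "finite_complex (insert (insert v \<sigma>) (insert \<sigma> K))"
    using assms by (intro finite_complex_insert) auto
  then show ?thesis
    by (simp add: insert_commute)
qed

lemma morse_finite_complex: "morse n K \<Longrightarrow> finite_complex K"
proof (induction rule: morse.induct)
  case empty
  show ?case
    by (simp add: finite_complex_def)
next
  case (pair K \<sigma> v)
  then show ?case
    by (intro finite_complex_insert_pair) auto
next
  case (critical K \<sigma>)
  then show ?case
    by (intro finite_complex_insert) auto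
qed

lemma realization_points_void [simp]: "realization_points {} = {}"
  by (simp add: realization_points_def)

lemma realization_points_vertex:
  assumes "{v} \<in> K"
  shows "realization_points K \<noteq> {}"
proof -
  have "(\<lambda>u. if u = v then 1 else 0) \<in> realization_points K"
    by (rule realization_pointsI[of "{v}"]) (use assms in auto)
  then show ?thesis
    by blast
qed

text \<open>By the size bound, a critical simplex is never a proper face of a simplex added later.
  So the pairs alone already form a construction of a complex \<open>C\<close> by elementary
  expansions. Each pair cancels in the alternating sum. The last clause excludes the void case,
  whose realization is contractible only by convention.\<close>

lemma morse_split:
  assumes "morse n K" "\<And>\<sigma>. \<sigma> \<in> K \<Longrightarrow> card \<sigma> \<le> n"
  obtains C F where "K = C \<union> F" "C \<inter> F = {}" "\<And>f. f \<in> F \<Longrightarrow> card f = n" "finite_complex C"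
    "contractible_space (geometric_realization C)" "(\<Sum>\<sigma>\<in>C. (-1) ^ card \<sigma> :: int) = 0"
    "C \<noteq> {} \<Longrightarrow> realization_points C \<noteq> {}"
  using assms
proof (induction arbitrary: thesis rule: morse.induct)
  case empty
  show ?case
    by (intro empty(1)[of "{}" "{}"]) (simp_all add: finite_complex_def geometric_realization_eq contractible_empty)
next
  case (pair K \<sigma> v)
  obtain C F where K: "K = C \<union> F" "C \<inter> F = {}" and F: "\<And>f. f \<in> F \<Longrightarrow> card f = n"
    and C: "finite_complex C" "contractible_space (geometric_realization C)"
      "(\<Sum>\<sigma>\<in>C. (-1) ^ card \<sigma> :: int) = 0"
    using pair.IH pair.prems(2) by (metis insertCI)
  define C' where "C' = insert \<sigma> (insert (insert v \<sigma>) C)"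
  have face: "\<rho> \<in> C" if "\<rho> \<subset> insert v \<sigma>" "\<rho> \<noteq> \<sigma>" for \<rho>
  proof -
    have "card \<rho> < card (insert v \<sigma>)"
      using that(1) pair.hyps(2) by (intro psubset_card_mono) auto
    moreover have "card (insert v \<sigma>) \<le> n"
      by (rule pair.prems(2)) simp
    ultimately have "\<rho> \<notin> F"
      using F by force
    then show ?thesis
      using pair.hyps(6)[OF that] K by auto
  qed
  have C': "finite_complex C'"
    unfolding C'_def using C(1) pair.hyps face by (intro finite_complex_insert_pair)
  have contr: "contractible_space (geometric_realization C')"
  \<comment> \<open>The empty simplex can only be added to the void complex; this pairing creates
    the initial vertex and is not an expansion of a nonempty space.\<close>
  proof (cases "\<sigma> = {}")
    case True
    have "C = {}"
      using pair.hyps(4) True K finite_complexD(3)[OF C(1)] by blast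
    then show ?thesis
      using True contractible_realization_vertex by (simp add: C'_def)
  next
    case False
    then show ?thesis
      using contractible_elementary_expansion[OF C(1) _ False pair.hyps(3) _ C(2)]
        C' pair.hyps(4) K by (simp add: C'_def)
  qed
  have euler: "(\<Sum>\<sigma>\<in>C'. (-1) ^ card \<sigma> :: int) = 0"
  proof -
    have "\<sigma> \<noteq> insert v \<sigma>"
      using pair.hyps(3) by blast
    then show ?thesis
      using C(3) K pair.hyps finite_complexD(1)[OF C(1)] by (simp add: C'_def)
  qed
  have "{v} \<in> C'"
    by (rule finite_complexD(3)[OF C', of "insert v \<sigma>"]) (auto simp: C'_def)
  then have "realization_points C' \<noteq> {}"
    by (rule realization_points_vertex)
  moreover have "insert \<sigma> (insert (insert v \<sigma>) K) = C' \<union> F" "C' \<inter> F = {}"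
    using K pair.hyps by (auto simp: C'_def)
  ultimately show ?case
    using pair.prems(1)[of C' F] F C' contr euler by simp
next
  case (critical K \<sigma>)
  obtain C F where K: "K = C \<union> F" "C \<inter> F = {}" and F: "\<And>f. f \<in> F \<Longrightarrow> card f = n"
    and C: "finite_complex C" "contractible_space (geometric_realization C)"
      "(\<Sum>\<sigma>\<in>C. (-1) ^ card \<sigma> :: int) = 0" "C \<noteq> {} \<Longrightarrow> realization_points C \<noteq> {}"
    using critical.IH critical.prems(2) by (metis insertCI)
  show ?case
    using critical.hyps K F C by (intro critical.prems(1)[of C "insert \<sigma> F"]) auto
qed

text \<open>Pairs cancel in the alternating sum and every critical simplex contributes
  \<open>(-1) ^ n\<close>, so its absolute value counts the critical simplices. As \<open>n\<close>
  is positive, the empty simplex is not critical and \<open>C\<close> is not void.\<close>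

theorem morse_homotopy_equivalent_wedge:
  assumes K: "morse n K" "K \<noteq> {}" and card: "\<And>\<sigma>. \<sigma> \<in> K \<Longrightarrow> card \<sigma> \<le> n" and n: "0 < n"
  shows "geometric_realization K homotopy_equivalent_space
    wedge {..<nat \<bar>\<Sum>\<sigma>\<in>K. (-1) ^ card \<sigma>\<bar>} (\<lambda>_. nsphere (n - 1)) (\<lambda>_. sphere_basepoint)"
proof -
  obtain C F where K_eq: "K = C \<union> F" "C \<inter> F = {}" and crit: "\<And>f. f \<in> F \<Longrightarrow> card f = n"
    and base: "finite_complex C" "contractible_space (geometric_realization C)"
      "(\<Sum>\<sigma>\<in>C. (-1) ^ card \<sigma> :: int) = 0" "C \<noteq> {} \<Longrightarrow> realization_points C \<noteq> {}"
    using morse_split[OF K(1) card] by metis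
  have fin: "finite_complex K"
    using K(1) by (rule morse_finite_complex)
  interpret attached_facets C F n
    using base(1) fin K_eq crit n by unfold_locales auto
  have "{} \<in> K"
    using finite_complexD(3)[OF fin] K(2) by blast
  moreover have "{} \<notin> F"
    using crit[of "{}"] n by auto
  ultimately have "{} \<in> C"
    using K_eq(1) by blast
  then have "geometric_realization K homotopy_equivalent_space
      wedge {..<card F} (\<lambda>_. nsphere (n - 1)) (\<lambda>_. sphere_basepoint)"
    using homotopy_equivalent_wedge_attached_facets base(2,4) K_eq(1) by auto
  moreover
  have "(\<Sum>\<sigma>\<in>K. (-1) ^ card \<sigma> :: int) = int (card F) * (-1) ^ n"
    using base(3) crit finF finite_complexD(1)[OF base(1)] K_eq by (simp add: sum.union_disjoint)
  then have "nat \<bar>\<Sum>\<sigma>\<in>K. (-1) ^ card \<sigma>\<bar> = card F"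
    by (simp add: abs_mult power_abs)
  ultimately show ?thesis
    by simp
qed

lemma insert_mem_image_insert:
  assumes "m \<notin> \<rho>" "m \<notin> \<Union>L"
  shows "insert m \<rho> \<in> insert m ` L \<longleftrightarrow> \<rho> \<in> L"
proof
  assume "insert m \<rho> \<in> insert m ` L"
  then obtain \<tau> where "\<tau> \<in> L" "insert m \<rho> = insert m \<tau>"
    by blast
  moreover have "m \<notin> \<tau>"
    using \<open>\<tau> \<in> L\<close> assms(2) by blast
  ultimately show "\<rho> \<in> L"
    using insert_ident[OF assms(1)] by blast
qed blast

text \<open>Joining with the apex \<open>m\<close> turns each pair of the construction of
  \<open>L\<close> into a pair, and each critical simplex of size \<open>n\<close> into one of size
  \<open>Suc n\<close>. Faces without \<open>m\<close> are already present because
  \<open>L \<subseteq> K\<close>.\<close>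

lemma morse_cone:
  assumes "morse n L" "morse (Suc n) K" "L \<subseteq> K" "m \<notin> \<Union>K"
  shows "morse (Suc n) (K \<union> insert m ` L)"
  using assms(1,3)
proof (induction rule: morse.induct)
  case empty
  then show ?case
    using assms(2) by simp
next
  case (pair L \<sigma> v)
  note K = finite_complexD(3)[OF morse_finite_complex[OF assms(2)]]
  have \<sigma>: "\<sigma> \<in> K" "insert v \<sigma> \<in> K" "m \<notin> insert v \<sigma>"
    using pair.prems assms(4) by auto
  have inj: "insert m \<rho> \<in> insert m ` L \<longleftrightarrow> \<rho> \<in> L" if "m \<notin> \<rho>" for \<rho>
    using that pair.prems assms(4) by (intro insert_mem_image_insert) auto
  have "morse (Suc n) (insert (insert m \<sigma>) (insert (insert v (insert m \<sigma>)) (K \<union> insert m ` L)))"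
  proof (rule morse.pair)
    show "morse (Suc n) (K \<union> insert m ` L)"
      using pair by simp
    show "insert m \<sigma> \<notin> K \<union> insert m ` L"
      using assms(4) inj[of \<sigma>] \<sigma> pair.hyps by auto
    show "insert v (insert m \<sigma>) \<notin> K \<union> insert m ` L"
      unfolding insert_commute[of v m]
      using assms(4) inj[of "insert v \<sigma>"] \<sigma> pair.hyps(5) by auto
    fix \<rho> assume \<rho>: "\<rho> \<subset> insert v (insert m \<sigma>)" "\<rho> \<noteq> insert m \<sigma>"
    show "\<rho> \<in> K \<union> insert m ` L"
    proof (cases "m \<in> \<rho>")
      case True
      then have "\<rho> - {m} \<subset> insert v \<sigma>" "\<rho> - {m} \<noteq> \<sigma>" "\<rho> = insert m (\<rho> - {m})"
        using \<rho> by auto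
      then show ?thesis
        using pair.hyps(6) by (intro UnI2 image_eqI[of _ _ "\<rho> - {m}"])
    next
      case False
      then have "\<rho> \<subseteq> insert v \<sigma>"
        using \<rho> by auto
      then show ?thesis
        using K \<sigma> by blast
    qed
  qed (use pair.hyps \<sigma> in auto)
  then show ?case
    unfolding insert_commute[of v m] by simp
next
  case (critical L \<sigma>)
  note K = finite_complexD(3)[OF morse_finite_complex[OF assms(2)]]
  have \<sigma>: "\<sigma> \<in> K" "m \<notin> \<sigma>"
    using critical.prems assms(4) by auto
  have inj: "insert m \<sigma> \<in> insert m ` L \<longleftrightarrow> \<sigma> \<in> L"
    using \<sigma> critical.prems assms(4) by (intro insert_mem_image_insert) auto
  have "morse (Suc n) (insert (insert m \<sigma>) (K \<union> insert m ` L))"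
  proof (rule morse.critical)
    show "morse (Suc n) (K \<union> insert m ` L)"
      using critical by simp
    show "insert m \<sigma> \<notin> K \<union> insert m ` L"
      using assms(4) inj critical.hyps by auto
    fix \<rho> assume \<rho>: "\<rho> \<subset> insert m \<sigma>"
    show "\<rho> \<in> K \<union> insert m ` L"
    proof (cases "m \<in> \<rho>")
      case True
      then have "\<rho> - {m} \<subset> \<sigma>" "\<rho> = insert m (\<rho> - {m})"
        using \<rho> \<sigma>(2) by auto
      then show ?thesis
        using critical.hyps(5) by (intro UnI2 image_eqI[of _ _ "\<rho> - {m}"])
    next
      case False
      then have "\<rho> \<subseteq> \<sigma>"
        using \<rho> by auto
      then show ?thesis
        using K \<sigma> by blast
    qed
  qed (use critical.hyps \<sigma> in auto)
  then show ?case
    by simp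
qed

text \<open>Each simplex of \<open>T\<close> is paired with its own join with \<open>m\<close>, in
  an order of nondecreasing size, so no critical simplices arise.\<close>

lemma morse_matched_cone:
  assumes "morse n K" "finite T"
    and "\<And>\<sigma>. \<sigma> \<in> T \<Longrightarrow> finite \<sigma> \<and> \<sigma> \<notin> K \<and> m \<notin> \<sigma> \<and> insert m \<sigma> \<notin> K"
    and "\<And>\<sigma> \<rho>. \<lbrakk>\<sigma> \<in> T; \<rho> \<subset> \<sigma>\<rbrakk> \<Longrightarrow> \<rho> \<in> T \<or> \<rho> \<in> K \<and> insert m \<rho> \<in> K"
  shows "morse n (K \<union> T \<union> insert m ` T)"
  using assms(2-4)
proof (induction T rule: finite_psubset_induct)
  case (psubset T)
  show ?case
  proof (cases "T = {}")
    case True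
    then show ?thesis
      using assms(1) by simp
  next
    case False
    \<comment> \<open>A simplex of largest size is added last: it is not a proper face of any other
      member of \<open>T\<close>.\<close>
    have "Max (card ` T) \<in> card ` T"
      using False psubset.hyps by (intro Max_in) auto
    then obtain \<sigma> where "\<sigma> \<in> T" "Max (card ` T) = card \<sigma>"
      by blast
    then have \<sigma>: "\<sigma> \<in> T" "\<And>\<rho>. \<rho> \<in> T \<Longrightarrow> card \<rho> \<le> card \<sigma>"
      using psubset.hyps Max_ge[of "card ` T"] by auto
    define T' where "T' = T - {\<sigma>}"
    note T = psubset.prems(1)
    have *: "\<rho> \<in> T' \<or> \<rho> \<in> K \<and> insert m \<rho> \<in> K" if "\<tau> \<in> T" "\<rho> \<subset> \<tau>" for \<rho> \<tau>
    proof -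
      have "card \<rho> < card \<tau>"
        using T[OF that(1)] that(2) by (intro psubset_card_mono) auto
      then have "\<rho> \<noteq> \<sigma>"
        using \<sigma>(2)[OF that(1)] by auto
      then show ?thesis
        using psubset.prems(2)[OF that] by (simp add: T'_def)
    qed
    have IH: "morse n (K \<union> T' \<union> insert m ` T')"
    proof (rule psubset.IH)
      show "T' \<subset> T"
        using \<sigma> by (auto simp: T'_def)
    qed (use T * in \<open>auto simp: T'_def\<close>)
    have "morse n (insert \<sigma> (insert (insert m \<sigma>) (K \<union> T' \<union> insert m ` T')))"
    proof (rule morse.pair[OF IH])
      show "insert m \<sigma> \<notin> K \<union> T' \<union> insert m ` T'"
      proof -
        have "\<sigma> = \<rho>" if "insert m \<sigma> = insert m \<rho>" "\<rho> \<in> T" for \<rho>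
          using that T[OF that(2)] T[OF \<sigma>(1)] by (simp add: insert_ident)
        then show ?thesis
          using T[OF \<sigma>(1)] T by (auto simp: T'_def)
      qed
      fix \<rho> assume \<rho>: "\<rho> \<subset> insert m \<sigma>" "\<rho> \<noteq> \<sigma>"
      show "\<rho> \<in> K \<union> T' \<union> insert m ` T'"
      proof (cases "m \<in> \<rho>")
        case True
        then have "\<rho> - {m} \<subset> \<sigma>" and eq: "insert m (\<rho> - {m}) = \<rho>"
          using \<rho> T[OF \<sigma>(1)] by auto
        then have "\<rho> - {m} \<in> T' \<or> insert m (\<rho> - {m}) \<in> K"
          using *[OF \<sigma>(1)] by blast
        moreover have "\<rho> - {m} \<in> T' \<Longrightarrow> insert m (\<rho> - {m}) \<in> insert m ` T'"
          by (rule imageI)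
        ultimately show ?thesis
          unfolding eq by blast
      next
        case False
        then have "\<rho> \<subset> \<sigma>"
          using \<rho> by auto
        then show ?thesis
          using *[OF \<sigma>(1)] by auto
      qed
    qed (use T[OF \<sigma>(1)] in \<open>auto simp: T'_def\<close>)
    also have "insert \<sigma> (insert (insert m \<sigma>) (K \<union> T' \<union> insert m ` T')) = K \<union> T \<union> insert m ` T"
      using \<sigma>(1) by (auto simp: T'_def)
    finally show ?thesis .
  qed
qed

section \<open>Ideals of a poset\<close>

definition order_ideal :: "'a rel \<Rightarrow> 'a set \<Rightarrow> bool" where
  "order_ideal r J \<longleftrightarrow> (\<forall>y\<in>J. \<forall>x. (x, y) \<in> r \<longrightarrow> x \<in> J)"

text \<open>
  If \<open>u \<notin> J\<close>, this is the void complex: then the first principal ideal containing \<open>u\<close> that is added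
  to \<open>J\<close> contributes a full cone, the empty simplex being matched with the apex.
\<close>

definition complex_above :: "'a rel \<Rightarrow> 'a \<Rightarrow> 'a set \<Rightarrow> 'a set set" where
  "complex_above r u J = (if u \<in> J then order_complex r {y \<in> J. (u, y) \<in> r \<and> y \<noteq> u} else {})"

lemma order_complex_subset: "\<lbrakk>C \<in> order_complex r A; D \<subseteq> C\<rbrakk> \<Longrightarrow> D \<in> order_complex r A"
  by (auto simp: order_complex_def Chains_def intro: finite_subset)

text \<open>In the main case the new chains are of two kinds. Joins of \<open>m\<close> with old
  chains below \<open>m\<close> form a cone over the complex of the intersection, whose critical
  size is one less by \<open>less\<close>. The remaining chains below \<open>m\<close> that are not
  old are matched with their joins with \<open>m\<close>.\<close>

lemma morse_complex_above_insert:
  assumes r: "Partial_order r" and J: "order_ideal r J" and m: "m \<in> Field r"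
    and fin: "finite (closed_interval r u m)"
    and morse: "morse n (complex_above r u J)"
    and less: "\<lbrakk>m \<notin> J; (u, m) \<in> r; u \<noteq> m\<rbrakk> \<Longrightarrow>
      \<exists>n'. n = Suc n' \<and> morse n' (complex_above r u {y \<in> J. (y, m) \<in> r})"
    and eq: "\<lbrakk>m \<notin> J; u = m\<rbrakk> \<Longrightarrow> n = 0"
  shows "morse n (complex_above r u (J \<union> {y. (y, m) \<in> r}))"
proof -
  have refl: "\<And>x. x \<in> Field r \<Longrightarrow> (x, x) \<in> r" and trans: "\<And>x y z. \<lbrakk>(x, y) \<in> r; (y, z) \<in> r\<rbrakk> \<Longrightarrow> (x, z) \<in> r"
    and antisym: "\<And>x y. \<lbrakk>(x, y) \<in> r; (y, x) \<in> r\<rbrakk> \<Longrightarrow> x = y"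
    using r by (auto simp: partial_order_on_def preorder_on_def refl_on_def dest: transD antisymD)
  have Jdown: "x \<in> J" if "y \<in> J" "(x, y) \<in> r" for x y
    using J that by (auto simp: order_ideal_def)
  let ?J' = "J \<union> {y. (y, m) \<in> r}"
  consider "m \<in> J" | "(u, m) \<notin> r" | "m \<notin> J" "u = m" | "m \<notin> J" "(u, m) \<in> r" "u \<noteq> m"
    by blast
  then show ?thesis
  proof cases
    case 1
    then have "?J' = J"
      using Jdown by auto
    then show ?thesis
      using morse by simp
  next
    case 2
    then have "u \<in> ?J' \<longleftrightarrow> u \<in> J" "{y \<in> ?J'. (u, y) \<in> r \<and> y \<noteq> u} = {y \<in> J. (u, y) \<in> r \<and> y \<noteq> u}"
      using trans by auto
    then have "complex_above r u ?J' = complex_above r u J"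
      unfolding complex_above_def by simp
    then show ?thesis
      using morse by simp
  next
    case 3
    \<comment> \<open>Here \<open>u\<close> itself enters the ideal: the void complex becomes
      \<open>{{}}\<close>, and the empty simplex is critical of size 0, whence the assumption
      \<open>eq\<close>.\<close>
    then have "{y \<in> ?J'. (u, y) \<in> r \<and> y \<noteq> u} = {}"
      using Jdown antisym by auto
    then have "complex_above r u ?J' = {{}}"
      using 3 refl[OF m] by (auto simp: complex_above_def order_complex_def Chains_def)
    moreover have "morse 0 {{} :: 'a set}"
      using morse.critical[OF morse.empty, of "{}" 0] by auto
    ultimately show ?thesis
      using eq[OF 3] by simp
  next
    case 4
    let ?L = "{y \<in> J. (y, m) \<in> r}"
    let ?A = "complex_above r u"
    obtain n' where n': "n = Suc n'" "morse n' (?A ?L)"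
      using less[OF 4] by blast
    have LJ: "?A ?L \<subseteq> ?A J"
      by (auto simp: complex_above_def order_complex_def)
    have mJ: "m \<notin> \<Union>(?A J)"
      using 4(1) by (auto simp: complex_above_def order_complex_def)
    define K where "K = ?A J \<union> insert m ` ?A ?L"
    have K: "morse n K"
      unfolding K_def n'(1) using n' morse LJ mJ by (intro morse_cone) auto
    define I where "I = {y. (u, y) \<in> r \<and> (y, m) \<in> r \<and> y \<noteq> u \<and> y \<noteq> m}"
    have finI: "finite I"
      by (rule finite_subset[OF _ fin]) (auto simp: I_def closed_interval_def)
    \<comment> \<open>The new chains that avoid \<open>m\<close>. If \<open>u\<close> is not in
      \<open>J\<close>, this includes the empty chain, which is then matched with the vertex
      \<open>m\<close>.\<close>
    define T where "T = order_complex r I - ?A J"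
    have L: "D \<in> ?A ?L" if "D \<in> ?A J" "D \<in> order_complex r I" for D
      using that 4 by (auto simp: complex_above_def order_complex_def I_def split: if_splits)
    have T_simplex: "finite \<sigma> \<and> \<sigma> \<notin> K \<and> m \<notin> \<sigma> \<and> insert m \<sigma> \<notin> K" if \<sigma>: "\<sigma> \<in> T" for \<sigma>
    proof -
      have m\<sigma>: "m \<notin> \<sigma>" "finite \<sigma>"
        using \<sigma> by (auto simp: T_def order_complex_def I_def)
      have "insert m \<sigma> \<noteq> insert m \<rho>" if "\<rho> \<in> ?A ?L" for \<rho>
      proof
        assume "insert m \<sigma> = insert m \<rho>"
        moreover have "m \<notin> \<rho>"
          using that LJ mJ by blast
        ultimately have "\<sigma> = \<rho>"
          using m\<sigma> by (simp add: insert_ident)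
        then show False
          using that LJ \<sigma> by (auto simp: T_def)
      qed
      then show ?thesis
        using m\<sigma> \<sigma> mJ by (auto simp: K_def T_def)
    qed
    have "morse n (K \<union> T \<union> insert m ` T)"
    proof (rule morse_matched_cone[OF K])
      have "order_complex r I \<subseteq> Pow I"
        by (auto simp: order_complex_def)
      then show "finite T"
        using finI by (auto simp: T_def intro: finite_subset)
      show "\<rho> \<in> T \<or> \<rho> \<in> K \<and> insert m \<rho> \<in> K" if "\<sigma> \<in> T" "\<rho> \<subset> \<sigma>" for \<sigma> \<rho>
      proof (cases "\<rho> \<in> ?A J")
        case True
        then have "\<rho> \<in> ?A ?L"
          using that order_complex_subset[of \<sigma> r I \<rho>] by (intro L) (auto simp: T_def)
        then show ?thesis
          using True by (auto simp: K_def)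
      next
        case False
        then show ?thesis
          using that order_complex_subset[of \<sigma> r I \<rho>] by (auto simp: T_def)
      qed
    qed (use T_simplex in auto)
    also have "K \<union> T \<union> insert m ` T = ?A ?J'"
    proof (intro equalityI subsetI)
      have I_sub: "I \<subseteq> {y \<in> ?J'. (u, y) \<in> r \<and> y \<noteq> u}"
        by (auto simp: I_def)
      have uJ': "u \<in> ?J'"
        using 4 by simp
      have add_m: "insert m D \<in> ?A ?J'" if "D \<in> order_complex r I" for D
        using that uJ' I_sub 4 refl[OF m]
        by (auto simp: complex_above_def order_complex_def Chains_def I_def)
      fix D assume "D \<in> K \<union> T \<union> insert m ` T"
      moreover have "?A J \<subseteq> ?A ?J'"
        by (auto simp: complex_above_def order_complex_def)
      moreover have "T \<subseteq> ?A ?J'"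
        using I_sub uJ' by (auto simp: T_def complex_above_def order_complex_def)
      moreover have "?A ?L \<subseteq> order_complex r I"
        using 4 by (auto simp: complex_above_def order_complex_def I_def)
      moreover have "T \<subseteq> order_complex r I"
        by (simp add: T_def)
      ultimately show "D \<in> ?A ?J'"
        using add_m by (auto simp: K_def)
    next
      fix D assume "D \<in> ?A ?J'"
      then have D: "D \<subseteq> ?J'" "finite D" "\<And>y. y \<in> D \<Longrightarrow> (u, y) \<in> r \<and> y \<noteq> u"
        and chain: "\<And>x y. x \<in> D \<Longrightarrow> y \<in> D \<Longrightarrow> (x, y) \<in> r \<or> (y, x) \<in> r"
        by (auto simp: complex_above_def order_complex_def Chains_def split: if_splits)
      \<comment> \<open>One element \<open>x\<close> outside \<open>J\<close> forces the whole chain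
        below \<open>m\<close>: elements under \<open>x\<close> are below \<open>m\<close> by
        transitivity, and elements above \<open>x\<close> are outside \<open>J\<close> as well
        because \<open>J\<close> is an ideal.\<close>
      have below: "(y, m) \<in> r" if "x \<in> D" "x \<notin> J" "y \<in> D" for x y
      proof -
        have "(x, m) \<in> r"
          using D(1) that by auto
        then show ?thesis
          using chain[OF that(1,3)] Jdown[of y x] that D(1) trans[of y x m] by blast
      qed
      have sub_I: "D - {m} \<in> order_complex r I" if "\<And>y. y \<in> D \<Longrightarrow> (y, m) \<in> r"
        using that D chain by (auto simp: order_complex_def Chains_def I_def)
      show "D \<in> K \<union> T \<union> insert m ` T"
      proof (cases "m \<in> D")
        case True
        then have "D - {m} \<in> order_complex r I"
          using below[OF True 4(1)] by (intro sub_I) auto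
        moreover have eq: "insert m (D - {m}) = D"
          using True by auto
        ultimately have "D - {m} \<in> ?A ?L \<or> D - {m} \<in> T"
          using L by (auto simp: T_def)
        then have "insert m (D - {m}) \<in> insert m ` ?A ?L \<union> insert m ` T"
          by blast
        then show ?thesis
          unfolding eq K_def by blast
      next
        case False
        show ?thesis
        proof (cases "D \<in> ?A J")
          case True
          then show ?thesis
            by (simp add: K_def)
        next
          case notJ: False
          have "(y, m) \<in> r" if y: "y \<in> D" for y
          proof (cases "D \<subseteq> J")
            case True
            then have "u \<in> J"
              using y D(3) Jdown by blast
            then have "D \<in> ?A J"
              using True D chain by (auto simp: complex_above_def order_complex_def Chains_def)
            then show ?thesis
              using notJ by simp
          next
            case False
            then show ?thesis
              using below y by blast
          qed
          then have "D - {m} \<in> order_complex r I"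
            by (rule sub_I)
          then show ?thesis
            using False notJ by (simp add: T_def)
        qed
      qed
    qed
    finally show ?thesis .
  qed
qed

section \<open>Ideals of words over a poset of rank at most one\<close>

lemma list_emb_append_right:
  assumes "list_emb R y (p @ s)"
  shows "\<exists>y1 y2. y = y1 @ y2 \<and> list_emb R y1 p \<and> list_emb R y2 s"
  using assms
proof (induction p arbitrary: y)
  case (Cons b p)
  from Cons.prems have "list_emb R y (b # (p @ s))"
    by simp
  then show ?case
  proof (cases rule: list_emb.cases)
    case list_emb_Nil
    then show ?thesis
      by auto
  next
    case list_emb_Cons
    then obtain y1 y2 where "y = y1 @ y2" "list_emb R y1 p" "list_emb R y2 s"
      using Cons.IH by blast
    then show ?thesis
      by (intro exI[of _ y1] exI[of _ y2]) auto
  next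
    case (list_emb_Cons2 c x)
    then obtain y1 y2 where "x = y1 @ y2" "list_emb R y1 p" "list_emb R y2 s"
      using Cons.IH by blast
    then show ?thesis
      using list_emb_Cons2 by (intro exI[of _ "c # y1"] exI[of _ y2]) auto
  qed
qed auto

locale rank_one_poset =
  fixes P :: "'a rel"
  assumes po: "Partial_order P" and fin: "finite (Field P)"
    and rank1: "\<lbrakk>(a, b) \<in> P; (b, c) \<in> P\<rbrakk> \<Longrightarrow> a = b \<or> b = c"
begin

section \<open>Splitting and joining embeddings of words\<close>

abbreviation "S \<equiv> subword_order P"
abbreviation "words \<equiv> lists (Field P)"

lemma P_refl: "a \<in> Field P \<Longrightarrow> (a, a) \<in> P"
  using po by (auto simp: partial_order_on_def preorder_on_def refl_on_def)

lemma S_iff: "(u, w) \<in> S \<longleftrightarrow> u \<in> words \<and> w \<in> words \<and> list_emb (\<lambda>x y. (x, y) \<in> P) u w"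
  by (rule subword_order_iff_list_emb)

lemma S_po: "Partial_order S"
  using po by (rule Partial_order_subword_order)

lemma S_refl: "w \<in> words \<Longrightarrow> (w, w) \<in> S"
  using S_po Field_subword_order[OF po] by (auto simp: partial_order_on_def preorder_on_def refl_on_def)

lemma S_trans: "\<lbrakk>(x, y) \<in> S; (y, z) \<in> S\<rbrakk> \<Longrightarrow> (x, z) \<in> S"
  using S_po by (auto simp: partial_order_on_def preorder_on_def dest: transD)

lemma S_words: "(u, w) \<in> S \<Longrightarrow> u \<in> words" "(u, w) \<in> S \<Longrightarrow> w \<in> words"
  by (auto simp: S_iff)

lemma S_append: "\<lbrakk>(u, v) \<in> S; (u', v') \<in> S\<rbrakk> \<Longrightarrow> (u @ u', v @ v') \<in> S"
  by (simp add: S_iff list_emb_append_mono)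

lemma S_append_right:
  assumes "(y, p @ s) \<in> S"
  obtains y1 y2 where "y = y1 @ y2" "(y1, p) \<in> S" "(y2, s) \<in> S"
proof -
  obtain y1 y2 where y: "y = y1 @ y2" "list_emb (\<lambda>x y. (x, y) \<in> P) y1 p"
    "list_emb (\<lambda>x y. (x, y) \<in> P) y2 s"
    using assms list_emb_append_right by (metis S_iff)
  then have "(y1, p) \<in> S" "(y2, s) \<in> S"
    using assms by (auto simp: S_iff)
  then show ?thesis
    using y(1) that by blast
qed

lemma S_Nil: "w \<in> words \<Longrightarrow> ([], w) \<in> S"
  by (simp add: S_iff)

lemma S_Nil2: "(w, []) \<in> S \<Longrightarrow> w = []"
  by (auto simp: S_iff dest: list_emb_Nil2)

lemma S_drop_left: "(x @ y, s) \<in> S \<Longrightarrow> (y, s) \<in> S"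
proof -
  assume xy: "(x @ y, s) \<in> S"
  then have "(y, x @ y) \<in> S"
    using S_append[OF S_Nil S_refl, of x y] S_words(1)[OF xy] by simp
  then show ?thesis
    using xy by (rule S_trans)
qed

lemma S_prefix: "x @ y \<in> words \<Longrightarrow> (x, x @ y) \<in> S"
  using S_append[OF S_refl S_Nil, of x y] by simp

lemma S_add_letter: "\<lbrakk>(x, s) \<in> S; b \<in> Field P\<rbrakk> \<Longrightarrow> (x, b # s) \<in> S"
  using S_append[OF S_Nil, of "[b]" x s] by simp

lemma S_Cons: "\<lbrakk>(c, b) \<in> P; (x, s) \<in> S\<rbrakk> \<Longrightarrow> (c # x, b # s) \<in> S"
  by (auto simp: S_iff Field_def)

lemma S_Cons_cases:
  assumes "(c # x, b # s) \<in> S"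
  obtains "(c # x, s) \<in> S" | "(c, b) \<in> P" "(x, s) \<in> S"
proof -
  have w: "c # x \<in> words" "b # s \<in> words" and e: "list_emb (\<lambda>x y. (x, y) \<in> P) (c # x) (b # s)"
    using assms by (auto simp: S_iff)
  from e show ?thesis
    by (cases rule: list_emb.cases) (use w that in \<open>auto simp: S_iff\<close>)
qed

lemma S_length: "(u, w) \<in> S \<Longrightarrow> length u \<le> length w"
  by (auto simp: S_iff dest: list_emb_length)

section \<open>Weights of letters and words\<close>

definition minimal_letter :: "'a \<Rightarrow> bool" where
  "minimal_letter b \<longleftrightarrow> (\<forall>a. (a, b) \<in> P \<longrightarrow> a = b)"

text \<open>One more than the rank of the letter in \<open>P\<close>. A word is reduced by deleting
  a letter of weight 1 or by lowering a letter of weight 2, and either step lowers \<open>wt\<close>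
  by one; so \<open>wt\<close> will turn out to be the rank function.\<close>

definition weight :: "'a \<Rightarrow> nat" where
  "weight b = (if minimal_letter b then 1 else 2)"

definition wt :: "'a list \<Rightarrow> nat" where
  "wt w = sum_list (map weight w)"

lemma wt_simps [simp]: "wt [] = 0" "wt (b # w) = weight b + wt w" "wt (v @ w) = wt v + wt w"
  by (simp_all add: wt_def)

lemma weight_pos: "0 < weight b"
  by (simp add: weight_def)

lemma below_imp_minimal_letter: "\<lbrakk>(a, b) \<in> P; a \<noteq> b\<rbrakk> \<Longrightarrow> minimal_letter a \<and> \<not> minimal_letter b"
  using rank1 by (auto simp: minimal_letter_def)

lemma weight_mono: "(a, b) \<in> P \<Longrightarrow> weight a \<le> weight b \<and> (weight a = weight b \<longrightarrow> a = b)"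
  using below_imp_minimal_letter[of a b] by (cases "a = b") (auto simp: weight_def)

lemma wt_mono_aux:
  "list_emb (\<lambda>x y. (x, y) \<in> P) u w \<Longrightarrow> wt u \<le> wt w \<and> (wt u = wt w \<longrightarrow> u = w)"
proof (induction rule: list_emb.induct)
  case (list_emb_Nil ys)
  then show ?case
    using weight_pos by (cases ys) (auto simp: Suc_le_eq)
next
  case (list_emb_Cons xs ys y)
  then show ?case
    using weight_pos[of y] by auto
next
  case (list_emb_Cons2 x y xs ys)
  then show ?case
    using weight_mono[of x y] by auto
qed

lemma wt_mono: "(u, w) \<in> S \<Longrightarrow> wt u \<le> wt w"
  using wt_mono_aux by (simp add: S_iff)

lemma wt_strict_mono: "(u, w) \<in> S \<Longrightarrow> u \<noteq> w \<Longrightarrow> wt u < wt w"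
  using wt_mono_aux[of u w] by (auto simp: S_iff order_less_le)

text \<open>
  The words below \<open>p @ s\<close> whose greedy embedding from the right leaves part of \<open>p\<close> unused. These are
  the ideals occurring in a recursive coatom ordering that reduces letters from left to right.
\<close>

definition prefix_ideal :: "'a list \<Rightarrow> 'a list \<Rightarrow> 'a list set" where
  "prefix_ideal p s = {y1 @ y2 | y1 y2. (y1, p) \<in> S \<and> y1 \<noteq> p \<and> (y2, s) \<in> S}"

lemma prefix_idealI: "\<lbrakk>(y1, p) \<in> S; y1 \<noteq> p; (y2, s) \<in> S\<rbrakk> \<Longrightarrow> y1 @ y2 \<in> prefix_ideal p s"
  by (auto simp: prefix_ideal_def)

lemma prefix_ideal_mono: "\<lbrakk>y \<in> prefix_ideal p s; (s, s') \<in> S\<rbrakk> \<Longrightarrow> y \<in> prefix_ideal p s'"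
  unfolding prefix_ideal_def using S_trans by blast

lemma prefix_ideal_below: "y \<in> prefix_ideal p s \<Longrightarrow> (y, p @ s) \<in> S"
  unfolding prefix_ideal_def using S_append by blast

text \<open>A smaller word splits along \<open>y1 @ y2\<close>, and its first half has weight less
  than \<open>wt p\<close>, so it differs from \<open>p\<close>.\<close>

lemma order_ideal_prefix_ideal: "order_ideal S (prefix_ideal p s)"
  unfolding order_ideal_def
proof (intro ballI allI impI)
  fix y x assume "y \<in> prefix_ideal p s" "(x, y) \<in> S"
  then obtain y1 y2 where y: "(y1, p) \<in> S" "y1 \<noteq> p" "(y2, s) \<in> S" "(x, y1 @ y2) \<in> S"
    by (auto simp: prefix_ideal_def)
  then obtain x1 x2 where x: "x = x1 @ x2" "(x1, y1) \<in> S" "(x2, y2) \<in> S"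
    by (elim S_append_right)
  have "wt x1 < wt p"
    using wt_mono[OF x(2)] wt_strict_mono[OF y(1,2)] by simp
  then show "x \<in> prefix_ideal p s"
    unfolding x(1) using S_trans[OF x(2) y(1)] S_trans[OF x(3) y(3)] by (intro prefix_idealI) auto
qed

lemma order_ideal_principal: "order_ideal S {y. (y, m) \<in> S}"
  unfolding order_ideal_def using S_trans by blast

lemma prefix_ideal_Nil: "prefix_ideal [] s = {}"
  using S_Nil2 by (auto simp: prefix_ideal_def)

lemma prefix_ideal_Nil2: "prefix_ideal w [] = {y. (y, w) \<in> S \<and> y \<noteq> w}"
proof (intro equalityI subsetI)
  fix y assume "y \<in> prefix_ideal w []"
  then show "y \<in> {y. (y, w) \<in> S \<and> y \<noteq> w}"
    by (auto simp: prefix_ideal_def dest: S_Nil2)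
next
  fix y assume "y \<in> {y. (y, w) \<in> S \<and> y \<noteq> w}"
  then show "y \<in> prefix_ideal w []"
    using prefix_idealI[of y w "[]" "[]"] S_Nil[of "[]"] by simp
qed

text \<open>The front part of a word on the left is \<open>z @ x\<close> with \<open>z\<close> below
  \<open>p\<close> and \<open>x\<close> below \<open>[b]\<close>. If \<open>z\<close> is not
  \<open>p\<close>, then \<open>x\<close> can be moved to the tail. Otherwise \<open>x\<close> is
  not \<open>[b]\<close>, so \<open>b\<close> has been deleted or lowered.\<close>

lemma prefix_ideal_snoc:
  assumes w: "p @ b # s \<in> words"
  shows "prefix_ideal (p @ [b]) s = prefix_ideal p (b # s) \<union> {y. (y, p @ s) \<in> S} \<union>
    (\<Union>c\<in>{c. (c, b) \<in> P \<and> c \<noteq> b}. {y. (y, p @ c # s) \<in> S})" (is "?L = ?R")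
proof (intro equalityI subsetI)
  fix y assume "y \<in> ?L"
  then obtain y1 y2 where y: "y = y1 @ y2" "(y1, p @ [b]) \<in> S" "y1 \<noteq> p @ [b]" "(y2, s) \<in> S"
    by (auto simp: prefix_ideal_def)
  from y(2) obtain z x where z: "y1 = z @ x" "(z, p) \<in> S" "(x, [b]) \<in> S"
    by (rule S_append_right)
  show "y \<in> ?R"
  proof (cases "z = p")
    case False
    then have "z @ (x @ y2) \<in> prefix_ideal p (b # s)"
      using z S_append[OF z(3) y(4)] by (intro prefix_idealI) auto
    then show ?thesis
      using y(1) z(1) by simp
  next
    case True
    show ?thesis
    proof (cases x)
      case Nil
      then have "(y, p @ s) \<in> S"
        using S_append[OF z(2) y(4)] y(1) z(1) by simp
      then show ?thesis
        by simp
    next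
      case (Cons c x')
      with z(3) have "(c # x', [b]) \<in> S"
        by simp
      then have c: "(c, b) \<in> P" "x' = []"
        using S_Nil2 by (auto elim!: S_Cons_cases)
      then have "c \<noteq> b"
        using y(3) z(1) True Cons by auto
      moreover have "(c, c) \<in> P"
        using c(1) by (intro P_refl) (auto simp: Field_def)
      then have "(p @ (c # y2), p @ (c # s)) \<in> S"
        using S_append[OF S_refl S_Cons] w y(4) by auto
      ultimately show ?thesis
        using c y(1) z(1) True Cons by auto
    qed
  qed
next
  \<comment> \<open>All three kinds of words on the right are treated alike: the drop in weight
    certifies that the front part is not \<open>p @ [b]\<close>.\<close>
  have strict: "z @ x @ y2 \<in> ?L"
    if "(z, p) \<in> S" "(x, [c]) \<in> S \<or> x = []" "(c, b) \<in> P" "(y2, s) \<in> S" "wt z + wt x < wt p + weight b"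
    for z x y2 c
  proof -
    have "(x, [b]) \<in> S"
    proof -
      have "([c], [b]) \<in> S"
        using S_Cons[OF that(3)] S_refl[of "[]"] by simp
      moreover have "([], [b]) \<in> S"
        using w by (intro S_Nil) auto
      ultimately show ?thesis
        using that(2) S_trans by blast
    qed
    then have "(z @ x, p @ [b]) \<in> S"
      using that(1) by (intro S_append)
    moreover have "z @ x \<noteq> p @ [b]"
      using that(5) by (metis wt_simps add.right_neutral less_irrefl)
    ultimately have "(z @ x) @ y2 \<in> ?L"
      using that(4) by (rule prefix_idealI)
    then show ?thesis
      by simp
  qed
  have bb: "(b, b) \<in> P"
    using w by (intro P_refl) auto
  fix y assume "y \<in> ?R"
  then consider "y \<in> prefix_ideal p (b # s)" | "(y, p @ s) \<in> S"
    | c where "(c, b) \<in> P" "c \<noteq> b" "(y, p @ c # s) \<in> S"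
    by blast
  then show "y \<in> ?L"
  proof cases
    case 1
    then obtain z t where z: "y = z @ t" "(z, p) \<in> S" "z \<noteq> p" "(t, [b] @ s) \<in> S"
      by (auto simp: prefix_ideal_def)
    from z(4) obtain x y2 where x: "t = x @ y2" "(x, [b]) \<in> S" "(y2, s) \<in> S"
      by (rule S_append_right)
    show ?thesis
      unfolding z(1) x(1) using z x bb wt_strict_mono[OF z(2,3)] wt_mono[OF x(2)]
      by (intro strict[of _ _ b]) auto
  next
    case 2
    then obtain z y2 where z: "y = z @ y2" "(z, p) \<in> S" "(y2, s) \<in> S"
      by (rule S_append_right)
    then show ?thesis
      using strict[of z "[]" b y2] bb wt_mono[OF z(2)] weight_pos[of b] by simp
  next
    case 3
    then obtain z t where z: "y = z @ t" "(z, p) \<in> S" "(t, [c] @ s) \<in> S"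
      by (auto elim: S_append_right)
    from z(3) obtain x y2 where x: "t = x @ y2" "(x, [c]) \<in> S" "(y2, s) \<in> S"
      by (rule S_append_right)
    have "weight c < weight b"
      using weight_mono[OF 3(1)] 3(2) by (auto simp: order_less_le)
    then show ?thesis
      unfolding z(1) x(1) using z x 3 wt_mono[OF z(2)] wt_mono[OF x(2)]
      by (intro strict[of _ _ c]) auto
  qed
qed

text \<open>
  If \<open>p @ z\<close> also embeds with a proper prefix of \<open>p\<close> in front, then all but the last letter of \<open>p\<close>
  may be taken as this prefix, and the last letter is matched either within \<open>s\<close> or with \<open>b\<close>.
\<close>

lemma full_prefix_in_prefix_ideal:
  assumes w: "p @ b # s \<in> words" and y: "p @ z \<in> prefix_ideal p (b # s)"
  shows "p @ z \<in> prefix_ideal p s \<or> (\<exists>p' c. p = p' @ [c] \<and> (c, b) \<in> P \<and> (z, s) \<in> S)"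
proof -
  obtain y1 y2 where y1: "p @ z = y1 @ y2" "(y1, p) \<in> S" "y1 \<noteq> p" "(y2, b # s) \<in> S"
    using y by (auto simp: prefix_ideal_def)
  obtain us where us: "p = y1 @ us" "us @ z = y2"
    using y1(1) S_length[OF y1(2)] y1(3) by (auto simp: append_eq_append_conv2)
  then have "us \<noteq> []"
    using y1(3) by auto
  then obtain q c where q: "us = q @ [c]"
    using rev_exhaust by blast
  have in_ideal: "p @ z \<in> prefix_ideal p s" if "(c # z, s) \<in> S"
  proof -
    have "(y1 @ q, p) \<in> S"
      using S_prefix[of "y1 @ q" "[c]"] w us q by auto
    then have "(y1 @ q) @ (c # z) \<in> prefix_ideal p s"
      using that us q by (intro prefix_idealI) auto
    then show ?thesis
      using us q by simp
  qed
  show ?thesis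
  proof (cases q)
    case Nil
    then have "(c # z, b # s) \<in> S"
      using y1(4) us q by simp
    then show ?thesis
      using in_ideal us q Nil by (auto elim: S_Cons_cases)
  next
    case (Cons a q')
    then have "(a # (q' @ c # z), b # s) \<in> S"
      using y1(4) us q by simp
    \<comment> \<open>At most the first letter \<open>a\<close> is matched with \<open>b\<close>, so
      the rest embeds in \<open>s\<close>.\<close>
    then have "(q' @ c # z, s) \<in> S"
      using S_drop_left[of "[a]"] by (auto elim: S_Cons_cases)
    then show ?thesis
      using in_ideal S_drop_left by blast
  qed
qed

text \<open>By \<open>full_prefix_in_prefix_ideal\<close>, the equality could fail only if the last
  letter of \<open>p\<close> lies below \<open>b\<close>, hence equals \<open>b\<close>. But then
  deleting that letter gives the same word as deleting \<open>b\<close>, so \<open>p @ s\<close> is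
  already in the earlier ideal, against \<open>m\<close>.\<close>

lemma meet_minimal:
  assumes w: "p @ b # s \<in> words" and b: "minimal_letter b" and m: "p @ s \<notin> prefix_ideal p (b # s)"
  shows "{y \<in> prefix_ideal p (b # s). (y, p @ s) \<in> S} = prefix_ideal p s"
proof (intro equalityI subsetI)
  fix y assume "y \<in> {y \<in> prefix_ideal p (b # s). (y, p @ s) \<in> S}"
  then have y: "y \<in> prefix_ideal p (b # s)" "(y, p @ s) \<in> S"
    by auto
  from y(2) obtain z1 z2 where z: "y = z1 @ z2" "(z1, p) \<in> S" "(z2, s) \<in> S"
    by (rule S_append_right)
  show "y \<in> prefix_ideal p s"
  proof (cases "z1 = p")
    case True
    have "\<not> (\<exists>p' c. p = p' @ [c] \<and> (c, b) \<in> P)"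
    proof clarify
      fix p' c assume p: "p = p' @ [c]" and "(c, b) \<in> P"
      then have "c = b"
        using b by (auto simp: minimal_letter_def)
      moreover have "p' @ (b # s) \<in> prefix_ideal p (b # s)"
        using w p S_prefix[of p' "[c]"] S_refl[of "b # s"] by (intro prefix_idealI) auto
      ultimately show False
        using m p by simp
    qed
    then show ?thesis
      using full_prefix_in_prefix_ideal[OF w, of z2] y(1) z(1) True by auto
  qed (use z prefix_idealI in auto)
next
  fix y assume y: "y \<in> prefix_ideal p s"
  have "(s, b # s) \<in> S"
    using w by (intro S_add_letter S_refl) auto
  then show "y \<in> {y \<in> prefix_ideal p (b # s). (y, p @ s) \<in> S}"
    using prefix_ideal_mono[OF y] prefix_ideal_below[OF y] by simp
qed

text \<open>Beyond \<open>prefix_ideal p (a # s)\<close>, the intersection can contain only words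
  below \<open>p @ s\<close>. The condition says when \<open>p @ s\<close> has been reached earlier:
  by a reduction of \<open>b\<close> to a letter in \<open>X\<close>, or because the last letter of
  \<open>p\<close> can take the place of \<open>b\<close>. In that case
  \<open>prefix_ideal_snoc\<close> combines both parts, as nothing lies strictly below
  \<open>a\<close>.\<close>

lemma meet_nonminimal:
  assumes w: "p @ b # s \<in> words" and X: "X \<subseteq> {a. (a, b) \<in> P \<and> a \<noteq> b}"
    and a: "(a, b) \<in> P" "a \<noteq> b" "a \<notin> X"
  shows "{y \<in> prefix_ideal p (b # s) \<union> (\<Union>a\<in>X. {y. (y, p @ a # s) \<in> S}). (y, p @ a # s) \<in> S} =
    (if X \<noteq> {} \<or> (\<exists>p' c. p = p' @ [c] \<and> (c, b) \<in> P) then prefix_ideal (p @ [a]) s else prefix_ideal p (a # s))"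
    (is "?L = (if ?cond then _ else _)")
proof -
  have ps: "p \<in> words" "s \<in> words" and aF: "a \<in> Field P"
    using w a(1) by (auto simp: Field_def)
  have wa: "p @ a # s \<in> words"
    using ps aF by simp
  have s_as: "(s, a' # s) \<in> S" if "a' \<in> Field P" for a'
    using ps that by (intro S_add_letter S_refl)
  have le_bs: "(a' # s, b # s) \<in> S" if "(a', b) \<in> P" for a'
    using that ps by (intro S_Cons S_refl)
  have a_min: "c = a" if "(c, a) \<in> P" for c
    using below_imp_minimal_letter[OF a(1,2)] that by (auto simp: minimal_letter_def)
  have snoc: "prefix_ideal (p @ [a]) s = prefix_ideal p (a # s) \<union> {y. (y, p @ s) \<in> S}"
    using prefix_ideal_snoc[OF wa] a_min by auto
  have 1: "y \<in> prefix_ideal p (a # s) \<or> ?cond \<and> (y, p @ s) \<in> S" if y: "y \<in> ?L" for y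
  proof -
    obtain z1 z2 where z: "y = z1 @ z2" "(z1, p) \<in> S" "(z2, a # s) \<in> S"
      using y by (auto elim: S_append_right)
    show ?thesis
    proof (cases "z1 = p")
      case False
      then show ?thesis
        using z prefix_idealI by auto
    next
      case True
      have ps_le: "(y, p @ s) \<in> S" if "(z2, s) \<in> S"
        using S_append[OF z(2) that] z(1) by simp
      have base: ?thesis if "y \<in> prefix_ideal p (b # s)"
        using full_prefix_in_prefix_ideal[OF w, of z2] that z(1) True ps_le prefix_ideal_mono[OF _ s_as[OF aF]] by auto
      consider "y \<in> prefix_ideal p (b # s)" | a' where "a' \<in> X" "(y, p @ a' # s) \<in> S"
        using y by blast
      then show ?thesis
      proof cases
        case 1
        then show ?thesis
          by (rule base)
      next
        case 2
        then have a': "(a', b) \<in> P" "a' \<noteq> b" "a' \<noteq> a"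
          using X a(3) by auto
        obtain x1 x2 where x: "y = x1 @ x2" "(x1, p) \<in> S" "(x2, a' # s) \<in> S"
          using 2(2) by (rule S_append_right)
        show ?thesis
        proof (cases "x1 = p")
          case False
          then show ?thesis
            using x prefix_idealI prefix_ideal_mono[OF _ le_bs[OF a'(1)]] by (intro base) auto
        next
          case eq: True
          then have "x2 = z2"
            using x(1) z(1) True by simp
          have "(z2, s) \<in> S"
          proof (cases z2)
            case Nil
            then show ?thesis
              using ps S_Nil by simp
          next
            case (Cons e t)
            have "(e # t, a # s) \<in> S" "(e # t, a' # s) \<in> S"
              using z(3) x(3) \<open>x2 = z2\<close> Cons by auto
            \<comment> \<open>Distinct letters strictly below \<open>b\<close> are minimal, hence
              without a common lower bound; here rank at most one is decisive.\<close>
            moreover have "\<not> ((e, a) \<in> P \<and> (e, a') \<in> P)"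
              using a_min below_imp_minimal_letter[OF a'(1,2)] a'(3) by (auto simp: minimal_letter_def)
            ultimately show ?thesis
              unfolding Cons by (auto elim!: S_Cons_cases)
          qed
          then show ?thesis
            using ps_le 2(1) by auto
        qed
      qed
    qed
  qed
  have 2: "y \<in> ?L" if y: "y \<in> prefix_ideal p (a # s)" for y
    using prefix_ideal_mono[OF y le_bs[OF a(1)]] prefix_ideal_below[OF y] by simp
  have 3: "y \<in> ?L" if y: "(y, p @ s) \<in> S" and "?cond" for y
  proof -
    have below: "(p @ s, p @ a' # s) \<in> S" if "a' \<in> Field P" for a'
      using S_append[OF S_refl s_as[OF that]] ps by simp
    have "p @ s \<in> prefix_ideal p (b # s) \<union> (\<Union>a\<in>X. {y. (y, p @ a # s) \<in> S})"
    proof (cases "X = {}")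
      case False
      then obtain a' where "a' \<in> X"
        by blast
      moreover from this have "a' \<in> Field P"
        using X by (auto simp: Field_def)
      ultimately show ?thesis
        using below by auto
    next
      case True
      then obtain p' c where p: "p = p' @ [c]" "(c, b) \<in> P"
        using \<open>?cond\<close> by blast
      have "p' @ (c # s) \<in> prefix_ideal p (b # s)"
        using S_prefix[of p' "[c]"] ps p le_bs[OF p(2)] by (intro prefix_idealI) auto
      then show ?thesis
        using p by simp
    qed
    then have "y \<in> prefix_ideal p (b # s) \<union> (\<Union>a\<in>X. {y. (y, p @ a # s) \<in> S})"
      using y order_ideal_prefix_ideal[of p "b # s"] S_trans unfolding order_ideal_def by blast
    moreover have "(y, p @ a # s) \<in> S"
      using y below[OF aF] by (rule S_trans)
    ultimately show ?thesis
      by simp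
  qed
  show ?thesis
  proof (cases ?cond)
    case True
    then show ?thesis
      using 1 2 3 snoc by auto
  next
    case False
    then show ?thesis
      using 1 2 by auto
  qed
qed

lemma finite_below: "finite {a. (a, b) \<in> P \<and> a \<noteq> b}"
  using fin by (rule finite_subset[rotated]) (auto simp: Field_def)

text \<open>The outer induction on the weight supplies the intersections, which belong to lighter
  words. The inner one moves letters of a fixed word \<open>w\<close> from the suffix to the prefix,
  starting from the void ideal. No relation between \<open>u\<close> and the word is assumed: until
  \<open>u\<close> is reached, the complex is void.\<close>

theorem morse_prefix_ideal:
  assumes "p @ s \<in> words"
  shows "morse (wt (p @ s) - wt u - 1) (complex_above S u (prefix_ideal p s))"
  using assms
proof (induction "wt (p @ s)" arbitrary: p s rule: less_induct)
  case less
  have add: "morse (wt w - wt u - 1) (complex_above S u (I \<union> {y. (y, m) \<in> S}))"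
    if "order_ideal S I" "m \<in> words" "wt w = Suc (wt m)"
      "morse (wt w - wt u - 1) (complex_above S u I)"
      "m \<notin> I \<Longrightarrow> morse (wt m - wt u - 1) (complex_above S u {y \<in> I. (y, m) \<in> S})" for I m w
  proof (rule morse_complex_above_insert[OF S_po that(1) _ _ that(4)])
    show "m \<in> Field S"
      using that(2) by (simp add: Field_subword_order[OF po])
    show "finite (closed_interval S u m)"
      using fin by (rule finite_closed_interval_subword_order)
    \<comment> \<open>From \<open>u\<close> strictly below \<open>m\<close> and
      \<open>wt w = Suc (wt m)\<close>, the weights of \<open>u\<close> and \<open>w\<close> differ
      by at least 2, so the subtraction is not truncated.\<close>
    show "\<exists>n'. wt w - wt u - 1 = Suc n' \<and> morse n' (complex_above S u {y \<in> I. (y, m) \<in> S})"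
      if "m \<notin> I" "(u, m) \<in> S" "u \<noteq> m"
      using wt_strict_mono[OF that(2,3)] \<open>wt w = Suc (wt m)\<close>
        \<open>m \<notin> I \<Longrightarrow> morse (wt m - wt u - 1) (complex_above S u {y \<in> I. (y, m) \<in> S})\<close> that(1)
      by (intro exI[of _ "wt m - wt u - 1"]) auto
    show "wt w - wt u - 1 = 0" if "m \<notin> I" "u = m"
      using \<open>wt w = Suc (wt m)\<close> that by simp
  qed
  have "morse (wt (p @ s) - wt u - 1) (complex_above S u (prefix_ideal p s))"
    if "p @ s = w" "w \<in> words" "\<And>p' s'. \<lbrakk>wt (p' @ s') < wt w; p' @ s' \<in> words\<rbrakk> \<Longrightarrow>
      morse (wt (p' @ s') - wt u - 1) (complex_above S u (prefix_ideal p' s'))" for w p s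
    using that
  proof (induction p arbitrary: s rule: rev_induct)
    case Nil
    then show ?case
      by (simp add: prefix_ideal_Nil complex_above_def morse.empty)
  next
    case (snoc b p)
    note IH = snoc.prems(3)
    have w: "p @ b # s = w" "p @ b # s \<in> words"
      using snoc.prems by auto
    then have ps: "p \<in> words" "s \<in> words"
      by auto
    have base: "morse (wt w - wt u - 1) (complex_above S u (prefix_ideal p (b # s)))"
      using snoc.IH[OF w(1) snoc.prems(2) IH] w by simp
    show ?case
    proof (cases "minimal_letter b")
      case True
      then have "{c. (c, b) \<in> P \<and> c \<noteq> b} = {}"
        by (auto simp: minimal_letter_def)
      then have "prefix_ideal (p @ [b]) s = prefix_ideal p (b # s) \<union> {y. (y, p @ s) \<in> S}"
        unfolding prefix_ideal_snoc[OF w(2)] by blast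
      moreover have "wt w = Suc (wt (p @ s))"
        using True by (simp flip: w(1) add: weight_def)
      ultimately show ?thesis
        using add[OF order_ideal_prefix_ideal _ _ base, of "p @ s"] IH[of p s] ps
          meet_minimal[OF w(2) True] w by auto
    next
      case False
      have lower: "wt w = Suc (wt (p @ a # s))" "a \<in> Field P" if "(a, b) \<in> P" "a \<noteq> b" for a
        using below_imp_minimal_letter[OF that] that by (auto simp flip: w(1) simp: weight_def Field_def)
      \<comment> \<open>The letters below \<open>b\<close> are processed one at a time, in any
        order; \<open>X\<close> collects those already done.\<close>
      have "morse (wt w - wt u - 1) (complex_above S u (prefix_ideal p (b # s) \<union> (\<Union>a\<in>X. {y. (y, p @ a # s) \<in> S})))"
        if "finite X" "X \<subseteq> {a. (a, b) \<in> P \<and> a \<noteq> b}" for X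
        using that
      proof (induction X rule: finite_induct)
        case empty
        then show ?case
          using base by simp
      next
        case (insert a X)
        let ?I = "prefix_ideal p (b # s) \<union> (\<Union>a\<in>X. {y. (y, p @ a # s) \<in> S})"
        have a: "(a, b) \<in> P" "a \<noteq> b"
          using insert.prems by auto
        have I: "order_ideal S ?I"
          using order_ideal_prefix_ideal[of p "b # s"] order_ideal_principal unfolding order_ideal_def by blast
        have X: "X \<subseteq> {a. (a, b) \<in> P \<and> a \<noteq> b}"
          using insert.prems by simp
        have "morse (wt (p @ a # s) - wt u - 1) (complex_above S u {y \<in> ?I. (y, p @ a # s) \<in> S})"
          unfolding meet_nonminimal[OF w(2) X a insert.hyps(2)]
          using IH[of "p @ [a]" s] IH[of p "a # s"] lower[OF a] ps by simp
        then have "morse (wt w - wt u - 1) (complex_above S u (?I \<union> {y. (y, p @ a # s) \<in> S}))"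
          using add[OF I _ lower(1)[OF a] insert.IH[OF X]] lower(2)[OF a] ps by auto
        then show ?case
          by (simp add: Un_ac)
      qed
      note * = this[OF finite_below order_refl]
      obtain a where a: "(a, b) \<in> P" "a \<noteq> b"
        using False by (auto simp: minimal_letter_def)
      have "(p @ s, p @ a # s) \<in> S"
        using S_append[OF S_refl[OF ps(1)] S_add_letter[OF S_refl[OF ps(2)] lower(2)[OF a]]] .
      \<comment> \<open>For nonminimal \<open>b\<close>, deletion would lower the weight by 2; its
        principal ideal is absorbed by that of a lowered letter.\<close>
      then have "{y. (y, p @ s) \<in> S} \<subseteq> {y. (y, p @ a # s) \<in> S}"
        using S_trans by blast
      then have "prefix_ideal (p @ [b]) s = prefix_ideal p (b # s) \<union> (\<Union>a\<in>{a. (a, b) \<in> P \<and> a \<noteq> b}. {y. (y, p @ a # s) \<in> S})"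
        using prefix_ideal_snoc[OF w(2)] a by blast
      then show ?thesis
        using * w by simp
    qed
  qed
  then show ?case
    using less by blast
qed

end

section \<open>Philip Hall's theorem\<close>

lemma finite_chain_has_top:
  assumes r: "Partial_order r" and "finite C" "C \<noteq> {}" "C \<in> Chains r"
  obtains x where "x \<in> C" "\<And>y. y \<in> C \<Longrightarrow> (y, x) \<in> r"
proof -
  have trans: "\<And>x y z. \<lbrakk>(x, y) \<in> r; (y, z) \<in> r\<rbrakk> \<Longrightarrow> (x, z) \<in> r"
    using r by (auto simp: partial_order_on_def preorder_on_def dest: transD)
  have "\<exists>x\<in>C. \<forall>y\<in>C. (y, x) \<in> r"
    using assms(2-4)
  proof (induction rule: finite_ne_induct)
    case (singleton x)
    then show ?case
      by (auto simp: Chains_def)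
  next
    case (insert z C)
    have "C \<in> Chains r"
      using insert.prems by (auto simp: Chains_def)
    then obtain x where x: "x \<in> C" "\<forall>y\<in>C. (y, x) \<in> r"
      using insert.IH by blast
    have "(z, x) \<in> r \<or> (x, z) \<in> r" "(z, z) \<in> r"
      using insert.prems x(1) by (auto simp: Chains_def)
    then show ?case
      using x trans by blast
  qed
  then show ?thesis
    using that by blast
qed

text \<open>Nonempty chains are sorted by their greatest element \<open>x\<close>; removing it
  leaves a chain in the open interval below \<open>x\<close> and flips the sign. The summand 1 is
  the empty chain.\<close>

lemma sum_order_complex_open_interval:
  assumes r: "Partial_order r" and fin: "finite (closed_interval r u w)"
  shows "(\<Sum>C\<in>order_complex r (open_interval r u w). (-1) ^ card C :: int) =
    1 - (\<Sum>x\<in>open_interval r u w. \<Sum>C\<in>order_complex r (open_interval r u x). (-1) ^ card C)"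
proof -
  have trans: "\<And>x y z. \<lbrakk>(x, y) \<in> r; (y, z) \<in> r\<rbrakk> \<Longrightarrow> (x, z) \<in> r"
    and antisym: "\<And>x y. \<lbrakk>(x, y) \<in> r; (y, x) \<in> r\<rbrakk> \<Longrightarrow> x = y"
    and refl: "\<And>x. x \<in> Field r \<Longrightarrow> (x, x) \<in> r"
    using r by (auto simp: partial_order_on_def preorder_on_def refl_on_def dest: transD antisymD)
  let ?I = "open_interval r u"
  let ?O = "\<lambda>x. order_complex r (?I x)"
  have finI: "finite (?I w)"
    using fin by (simp add: open_interval_def)
  have sub: "?I x \<subseteq> ?I w" if "x \<in> ?I w" for x
    using that unfolding open_interval_def closed_interval_def by (blast intro: trans dest: antisym)
  have finO: "finite (?O x)" if "?I x \<subseteq> ?I w" for x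
    by (rule finite_subset[of _ "Pow (?I w)"]) (use that finI in \<open>auto simp: order_complex_def\<close>)
  have notin: "x \<notin> C" if "C \<in> ?O x" for x C
    using that by (auto simp: order_complex_def open_interval_def)
  have decomp: "?O w = insert {} (\<Union>x\<in>?I w. insert x ` ?O x)"
  proof (intro equalityI subsetI)
    fix C assume C: "C \<in> ?O w"
    show "C \<in> insert {} (\<Union>x\<in>?I w. insert x ` ?O x)"
    proof (cases "C = {}")
      case False
      moreover have "finite C" "C \<in> Chains r"
        using C by (auto simp: order_complex_def)
      ultimately obtain x where x: "x \<in> C" "\<And>y. y \<in> C \<Longrightarrow> (y, x) \<in> r"
        using finite_chain_has_top[OF r] by blast
      have "C - {x} \<in> ?O x"
        using C x by (auto simp: order_complex_def open_interval_def closed_interval_def Chains_def)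
      then have "insert x (C - {x}) \<in> insert x ` ?O x"
        by (rule imageI)
      moreover have "insert x (C - {x}) = C"
        using x(1) by blast
      moreover have "x \<in> ?I w"
        using C x(1) by (auto simp: order_complex_def)
      ultimately show ?thesis
        by auto
    qed simp
  next
    fix C assume "C \<in> insert {} (\<Union>x\<in>?I w. insert x ` ?O x)"
    then consider "C = {}" | x D where "x \<in> ?I w" "D \<in> ?O x" "C = insert x D"
      by blast
    then show "C \<in> ?O w"
    proof cases
      case 1
      then show ?thesis
        by (simp add: order_complex_def Chains_def)
    next
      case 2
      have "(x, x) \<in> r"
        using 2(1) by (intro refl) (auto simp: open_interval_def closed_interval_def Field_def)
      moreover have "(y, x) \<in> r" if "y \<in> D" for y
        using 2(2) that by (auto simp: order_complex_def open_interval_def closed_interval_def)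
      ultimately show ?thesis
        using 2 sub[OF 2(1)] by (auto simp: order_complex_def Chains_def)
    qed
  qed
  have disj: "insert x ` ?O x \<inter> insert y ` ?O y = {}" if "x \<noteq> y" for x y
  proof (rule ccontr)
    assume "insert x ` ?O x \<inter> insert y ` ?O y \<noteq> {}"
    then obtain C D where CD: "C \<in> ?O x" "D \<in> ?O y" "insert x C = insert y D"
      by auto
    then have "x \<in> D" "y \<in> C"
      using that by auto
    then have "(x, y) \<in> r" "(y, x) \<in> r"
      using CD by (auto simp: order_complex_def open_interval_def closed_interval_def)
    then show False
      using antisym that by blast
  qed
  have "(\<Sum>C\<in>?O w. (-1) ^ card C :: int) = 1 + (\<Sum>C\<in>(\<Union>x\<in>?I w. insert x ` ?O x). (-1) ^ card C)"
    unfolding decomp using finI finO sub by (subst sum.insert) auto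
  also have "(\<Sum>C\<in>(\<Union>x\<in>?I w. insert x ` ?O x). (-1) ^ card C :: int) =
      (\<Sum>x\<in>?I w. \<Sum>C\<in>insert x ` ?O x. (-1) ^ card C)"
    using finI finO sub disj by (intro sum.UNION_disjoint) auto
  also have "\<dots> = (\<Sum>x\<in>?I w. - (\<Sum>C\<in>?O x. (-1) ^ card C))"
  proof (rule sum.cong[OF HOL.refl])
    fix x
    have "inj_on (insert x) (?O x)"
      using notin by (intro inj_onI) (metis insert_ident)
    then have "(\<Sum>C\<in>insert x ` ?O x. (-1) ^ card C :: int) = (\<Sum>C\<in>?O x. (-1) ^ card (insert x C))"
      by (simp add: sum.reindex)
    also have "\<dots> = (\<Sum>C\<in>?O x. - ((-1) ^ card C))"
      using notin by (intro sum.cong[OF HOL.refl]) (auto simp: order_complex_def)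
    finally show "(\<Sum>C\<in>insert x ` ?O x. (-1) ^ card C :: int) = - (\<Sum>C\<in>?O x. (-1) ^ card C)"
      by (simp add: sum_negf)
  qed
  finally show ?thesis
    by (simp add: sum_negf)
qed

lemma mobius_refl:
  assumes "Partial_order r" "(u, u) \<in> r"
  shows "mobius r u u = 1"
proof -
  have "closed_interval r u u = {u}"
    using assms by (auto simp: closed_interval_def partial_order_on_def dest: antisymD)
  then show ?thesis
    using assms by (simp add: mobius.simps)
qed

text \<open>The right-hand side is the reduced Euler characteristic, since a chain of
  \<open>k\<close> elements has dimension \<open>k - 1\<close> and the empty one counts. It
  satisfies the recursion that defines \<open>mobius\<close>.\<close>

theorem mobius_eq_sum_chains:
  assumes r: "Partial_order r" and "finite (closed_interval r u w)" "(u, w) \<in> r" "u \<noteq> w"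
  shows "mobius r u w = - (\<Sum>C\<in>order_complex r (open_interval r u w). (-1) ^ card C)"
  using assms(2-4)
proof (induction "card (closed_interval r u w)" arbitrary: w rule: less_induct)
  case less
  have trans: "\<And>x y z. \<lbrakk>(x, y) \<in> r; (y, z) \<in> r\<rbrakk> \<Longrightarrow> (x, z) \<in> r"
    and antisym: "\<And>x y. \<lbrakk>(x, y) \<in> r; (y, x) \<in> r\<rbrakk> \<Longrightarrow> x = y"
    and refl: "\<And>x. x \<in> Field r \<Longrightarrow> (x, x) \<in> r"
    using r by (auto simp: partial_order_on_def preorder_on_def refl_on_def dest: transD antisymD)
  have uw: "(u, u) \<in> r" "(w, w) \<in> r"
    using less.prems(2) refl by (auto simp: Field_def)
  have IH: "mobius r u x = - (\<Sum>C\<in>order_complex r (open_interval r u x). (-1) ^ card C)"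
    if x: "x \<in> open_interval r u w" for x
  proof -
    have x': "(u, x) \<in> r" "(x, w) \<in> r" "u \<noteq> x" "x \<noteq> w"
      using x by (auto simp: open_interval_def closed_interval_def)
    have "w \<notin> closed_interval r u x"
      unfolding closed_interval_def using x'(2,4) antisym by blast
    moreover have "closed_interval r u x \<subseteq> closed_interval r u w"
      unfolding closed_interval_def using trans[OF _ x'(2)] by blast
    moreover have "w \<in> closed_interval r u w"
      using less.prems(2) uw by (simp add: closed_interval_def)
    ultimately have "closed_interval r u x \<subset> closed_interval r u w"
      by blast
    then show ?thesis
      using less.prems(1) x' by (intro less.hyps) (auto intro: psubset_card_mono finite_subset)
  qed
  have split: "closed_interval r u w - {w} = insert u (open_interval r u w)"
    using less.prems uw by (auto simp: open_interval_def closed_interval_def)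
  have "mobius r u w = - (\<Sum>x\<in>closed_interval r u w - {w}. mobius r u x)"
    using r less.prems by (subst mobius.simps) simp
  also have "\<dots> = - (1 + (\<Sum>x\<in>open_interval r u w. mobius r u x))"
    unfolding split using less.prems(1) mobius_refl[OF r uw(1)]
    by (subst sum.insert) (auto simp: open_interval_def)
  also have "(\<Sum>x\<in>open_interval r u w. mobius r u x) =
      - (\<Sum>x\<in>open_interval r u w. \<Sum>C\<in>order_complex r (open_interval r u x). (-1) ^ card C)"
    using IH by (simp add: sum_negf)
  finally show ?case
    using sum_order_complex_open_interval[OF r less.prems(1)] by simp
qed

section \<open>Rank\<close>

text \<open>The chains counted by \<open>rank_in\<close> have to start at a minimal element, so
  \<open>a\<close> is first replaced by a minimal element \<open>m\<close> below it. Then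
  \<open>{m, b, c}\<close> has length 2.\<close>

lemma poset_rank_le_1_imp:
  assumes P: "Partial_order P" "finite (Field P)" "poset_rank P \<le> 1"
    and abc: "(a, b) \<in> P" "(b, c) \<in> P"
  shows "a = b \<or> b = c"
proof (rule ccontr)
  assume "\<not> (a = b \<or> b = c)"
  then have ne: "a \<noteq> b" "b \<noteq> c"
    by auto
  have trans: "\<And>x y z. \<lbrakk>(x, y) \<in> P; (y, z) \<in> P\<rbrakk> \<Longrightarrow> (x, z) \<in> P"
    and antisym: "\<And>x y. \<lbrakk>(x, y) \<in> P; (y, x) \<in> P\<rbrakk> \<Longrightarrow> x = y"
    and refl: "\<And>x. x \<in> Field P \<Longrightarrow> (x, x) \<in> P"
    using P(1) by (auto simp: partial_order_on_def preorder_on_def refl_on_def dest: transD antisymD)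
  have F: "a \<in> Field P" "b \<in> Field P" "c \<in> Field P"
    using abc by (auto simp: Field_def)
  let ?down = "\<lambda>x. {y. (y, x) \<in> P}"
  have fin: "finite (?down x)" for x
    by (rule finite_subset[OF _ P(2)]) (auto simp: Field_def)
  \<comment> \<open>An element with the smallest down-set among those below \<open>a\<close> is
    minimal in \<open>P\<close>.\<close>
  obtain m where m: "(m, a) \<in> P" "\<And>x. (x, a) \<in> P \<Longrightarrow> card (?down m) \<le> card (?down x)"
    using ex_has_least_nat[of "\<lambda>x. (x, a) \<in> P" a "\<lambda>x. card (?down x)"] refl[OF F(1)] by blast
  have mF: "(m, m) \<in> P" "m \<in> Field P"
    using m(1) refl by (auto simp: Field_def)
  have min: "minimal_element P m"
    unfolding minimal_element_def
  proof (intro conjI allI impI mF(2))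
    fix x assume x: "(x, m) \<in> P"
    show "x = m"
    proof (rule ccontr)
      assume "x \<noteq> m"
      then have "?down x \<subset> ?down m"
        using x mF trans antisym by blast
      then show False
        using psubset_card_mono[OF fin] m trans[OF x m(1)] by (metis leD)
    qed
  qed
  have le: "(m, b) \<in> P" "(m, c) \<in> P"
    using m(1) abc trans by blast+
  have distinct: "m \<noteq> b" "m \<noteq> c"
    using m(1) abc ne trans antisym by blast+
  let ?R = "{card C - 1 | C. C \<in> Chains P \<and> c \<in> C \<and> (\<forall>d\<in>C. (d, c) \<in> P) \<and>
     (\<exists>m\<in>C. minimal_element P m \<and> (\<forall>d\<in>C. (m, d) \<in> P))}"
  have "C \<subseteq> Field P" if "C \<in> Chains P" for C
    using that by (auto simp: Chains_def Field_def)
  then have "?R \<subseteq> (\<lambda>C. card C - 1) ` Pow (Field P)"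
    by blast
  then have "finite ?R"
    using P(2) by (meson finite_Pow_iff finite_imageI finite_subset)
  moreover have "card {m, b, c} - 1 \<in> ?R"
    using min le abc mF refl F by (intro CollectI exI[of _ "{m, b, c}"]) (auto simp: Chains_def)
  moreover have "card {m, b, c} - 1 = 2"
    using distinct ne by simp
  ultimately have "2 \<le> rank_in P c"
    unfolding rank_in_def by (metis (no_types, lifting) Max_ge)
  also have "\<dots> \<le> poset_rank P"
    unfolding poset_rank_def using P(2) F(3) by (intro cSUP_upper bdd_above_finite finite_imageI)
  finally show False
    using P(3) by simp
qed

section \<open>The rank of a word is its weight\<close>

context rank_one_poset
begin

text \<open>The first letter is always reduced: deleted if minimal, lowered otherwise. Each step
  costs weight one, so the chain down to the empty word passes through every weight.\<close>

lemma maximal_chain_to_word: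
  assumes "w \<in> words"
  shows "\<exists>C. finite C \<and> card C = Suc (wt w) \<and> w \<in> C \<and> [] \<in> C \<and> (\<forall>c\<in>C. (c, w) \<in> S) \<and>
    (\<forall>c\<in>C. \<forall>d\<in>C. (c, d) \<in> S \<or> (d, c) \<in> S)"
  using assms
proof (induction "wt w" arbitrary: w rule: less_induct)
  case less
  show ?case
  proof (cases w)
    case Nil
    then show ?thesis
      using S_Nil[of "[]"] by (intro exI[of _ "{[]}"]) auto
  next
    case (Cons b v)
    then have bv: "b \<in> Field P" "v \<in> words"
      using less.prems by auto
    have "\<exists>x. (x, w) \<in> S \<and> wt w = Suc (wt x)"
    proof (cases "minimal_letter b")
      case True
      then show ?thesis
        using S_add_letter[OF S_refl[OF bv(2)] bv(1)] Cons by (intro exI[of _ v]) (simp add: weight_def)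
    next
      case False
      then obtain a where a: "(a, b) \<in> P" "a \<noteq> b"
        by (auto simp: minimal_letter_def)
      then show ?thesis
        using S_Cons[OF a(1) S_refl[OF bv(2)]] below_imp_minimal_letter[OF a] Cons
        by (intro exI[of _ "a # v"]) (simp add: weight_def)
    qed
    then obtain x where x: "(x, w) \<in> S" "wt w = Suc (wt x)"
      by blast
    then obtain C where C: "finite C" "card C = Suc (wt x)" "x \<in> C" "[] \<in> C"
      "\<And>c. c \<in> C \<Longrightarrow> (c, x) \<in> S" "\<forall>c\<in>C. \<forall>d\<in>C. (c, d) \<in> S \<or> (d, c) \<in> S"
      using less.hyps[of x] S_words(1)[OF x(1)] by auto
    have below: "(c, w) \<in> S" "c \<noteq> w" if "c \<in> C" for c
      using S_trans[OF C(5)[OF that] x(1)] wt_mono[OF C(5)[OF that]] x(2) by auto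
    then have "w \<notin> C"
      by blast
    then show ?thesis
      using C below(1) x(2) S_refl[OF less.prems] by (intro exI[of _ "insert w C"]) auto
  qed
qed

lemma inj_on_wt:
  assumes "\<And>c d. \<lbrakk>c \<in> C; d \<in> C\<rbrakk> \<Longrightarrow> (c, d) \<in> S \<or> (d, c) \<in> S"
  shows "inj_on wt C"
proof (rule inj_onI)
  fix c d assume "c \<in> C" "d \<in> C" "wt c = wt d"
  then show "c = d"
    using assms[of c d] wt_strict_mono by (metis less_irrefl)
qed

text \<open>Weights are distinct along a chain and at most \<open>wt w\<close>, which bounds its
  length; \<open>maximal_chain_to_word\<close> attains the bound.\<close>

lemma word_rank_eq_wt:
  assumes w: "w \<in> words"
  shows "word_rank P w = wt w"
proof -
  define I where "I = closed_interval S [] w"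
  define R where "R = Restr S I"
  have I: "x \<in> I \<longleftrightarrow> (x, w) \<in> S" for x
    using S_Nil S_words by (auto simp: I_def closed_interval_def)
  have R: "(x, y) \<in> R \<longleftrightarrow> (x, y) \<in> S \<and> (y, w) \<in> S" for x y
    using I S_trans by (auto simp: R_def)
  have finI: "finite I"
    unfolding I_def using fin by (rule finite_closed_interval_subword_order)
  have min: "minimal_element R []"
    using R S_Nil[of "[]"] S_Nil[OF w] S_Nil2 by (auto simp: minimal_element_def Field_def)
  let ?Q = "\<lambda>C. C \<in> Chains R \<and> w \<in> C \<and> (\<forall>c\<in>C. (c, w) \<in> R) \<and>
     (\<exists>m\<in>C. minimal_element R m \<and> (\<forall>c\<in>C. (m, c) \<in> R))"
  have Q_I: "C \<subseteq> I" if "?Q C" for C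
    using that I R by auto
  have "Max {card C - 1 | C. ?Q C} = wt w"
  proof (rule Max_eqI)
    have "{card C - 1 | C. ?Q C} \<subseteq> (\<lambda>C. card C - 1) ` Pow I"
      using Q_I by blast
    then show "finite {card C - 1 | C. ?Q C}"
      using finI by (meson finite_Pow_iff finite_imageI finite_subset)
    show "k \<le> wt w" if "k \<in> {card C - 1 | C. ?Q C}" for k
    proof -
      from that have "\<exists>C. k = card C - 1 \<and> ?Q C"
        by (simp only: mem_Collect_eq)
      then obtain C where "k = card C - 1 \<and> ?Q C" ..
      then have C: "k = card C - 1" "?Q C"
        by (rule conjunct1, rule conjunct2)
      have "inj_on wt C"
        by (rule inj_on_wt) (use C(2) R in \<open>auto simp: Chains_def\<close>)
      moreover have "wt ` C \<subseteq> {..wt w}"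
        using C(2) R wt_mono by auto
      ultimately have "card C \<le> card {..wt w}"
        by (intro card_inj_on_le) auto
      then show ?thesis
        using C(1) by simp
    qed
    obtain C where C: "finite C" "card C = Suc (wt w)" "w \<in> C" "[] \<in> C" "\<forall>c\<in>C. (c, w) \<in> S"
      "\<forall>c\<in>C. \<forall>d\<in>C. (c, d) \<in> S \<or> (d, c) \<in> S"
      using maximal_chain_to_word[OF w] by blast
    have "([], c) \<in> R" if "c \<in> C" for c
      using that C(5) S_Nil[OF S_words(1)[of c w]] by (simp add: R)
    then have "?Q C"
      using C min R S_refl[OF w] by (auto simp: Chains_def)
    then show "wt w \<in> {card C - 1 | C. ?Q C}"
      using C(2) by (intro CollectI exI[of _ C]) simp
  qed
  then show ?thesis
    unfolding word_rank_def rank_in_def R_def[unfolded I_def, symmetric] .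
qed

lemma card_chain_open_interval:
  assumes C: "C \<in> order_complex S (open_interval S u w)"
  shows "card C \<le> wt w - wt u - 1"
proof -
  have "inj_on wt C"
    by (rule inj_on_wt) (use C in \<open>auto simp: order_complex_def Chains_def\<close>)
  moreover have "wt ` C \<subseteq> {wt u<..<wt w}"
  proof
    fix k assume "k \<in> wt ` C"
    then obtain c where "k = wt c" "(u, c) \<in> S" "c \<noteq> u" "(c, w) \<in> S" "c \<noteq> w"
      using C by (auto simp: order_complex_def open_interval_def closed_interval_def)
    then show "k \<in> {wt u<..<wt w}"
      using wt_strict_mono[of u c] wt_strict_mono[of c w] by auto
  qed
  ultimately have "card C \<le> card {wt u<..<wt w}"
    by (intro card_inj_on_le) auto
  then show ?thesis
    by simp
qed

lemma complex_above_proper_words: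
  assumes "(u, w) \<in> S" "u \<noteq> w"
  shows "complex_above S u (prefix_ideal w []) = order_complex S (open_interval S u w)"
proof -
  have "{y \<in> prefix_ideal w []. (u, y) \<in> S \<and> y \<noteq> u} = open_interval S u w"
    by (auto simp: prefix_ideal_Nil2 open_interval_def closed_interval_def)
  then show ?thesis
    using assms by (simp add: complex_above_def prefix_ideal_Nil2)
qed

end

lemma wedge_of_spheres_negative:
  assumes "d < 0" "k \<noteq> 0"
  shows "geometric_realization {{} :: 'v set} homotopy_equivalent_space wedge_of_spheres k d"
proof -
  have "realization_points {{} :: 'v set} = {}"
    using realization_pointsD(2,4)[of _ "{{} :: 'v set}"] by blast
  then have "geometric_realization {{} :: 'v set} = trivial_topology"
    by (simp add: geometric_realization_eq)
  then show ?thesis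
    using assms by (intro homeomorphic_imp_homotopy_equivalent_space)
      (simp add: wedge_of_spheres_def homeomorphic_empty_space_eq)
qed

theorem theorem4p1:
  fixes P :: "'a rel" and u w :: "'a list"
  assumes "Partial_order P" and "finite (Field P)" and "poset_rank P \<le> 1"
    and "(u, w) \<in> subword_order P"
  shows "geometric_realization
           (order_complex (subword_order P) (open_interval (subword_order P) u w))
         homotopy_equivalent_space
         wedge_of_spheres (nat \<bar>mobius (subword_order P) u w\<bar>)
           (int (word_rank P w) - int (word_rank P u) - 2)"
proof -
  interpret rank_one_poset P
    using assms(1,2) poset_rank_le_1_imp[OF assms(1-3)] by unfold_locales
  have rank: "word_rank P w = wt w" "word_rank P u = wt u"
    using word_rank_eq_wt S_words[OF assms(4)] by auto
  let ?K = "order_complex S (open_interval S u w)"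
  have empty: "{} \<in> ?K"
    by (simp add: order_complex_def Chains_def)
  show ?thesis
  proof (cases "u = w")
    case True
    \<comment> \<open>The degenerate case: the Moebius number is 1 and the dimension is -2, so the
      target is the empty space.\<close>
    then have "open_interval S u w = {}"
      using S_po by (auto simp: open_interval_def closed_interval_def partial_order_on_def dest: antisymD)
    then have "?K = {{}}"
      using empty by (auto simp: order_complex_def)
    moreover have "mobius S u w = 1"
      using mobius_refl[OF S_po] assms(4) True by simp
    ultimately show ?thesis
      using True by (simp add: wedge_of_spheres_negative)
  next
    case False
    define n where "n = wt w - wt u - 1"
    have less: "wt u < wt w"
      using wt_strict_mono[OF assms(4) False] .
    have mob: "\<bar>mobius S u w\<bar> = \<bar>\<Sum>C\<in>?K. (-1) ^ card C\<bar>"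
      using mobius_eq_sum_chains[OF S_po finite_closed_interval_subword_order[OF fin] assms(4) False]
      by simp
    have morse: "morse n ?K"
      using morse_prefix_ideal[of w "[]" u] S_words(2)[OF assms(4)] complex_above_proper_words[OF assms(4) False]
      by (simp add: n_def)
    have card: "card C \<le> n" if "C \<in> ?K" for C
      using card_chain_open_interval[OF that] by (simp add: n_def)
    show ?thesis
    proof (cases "n = 0")
      case True
      \<comment> \<open>Here \<open>w\<close> covers \<open>u\<close>: the only chain is empty, the
        Moebius number has absolute value 1, and the dimension is -1.\<close>
      then have "?K = {{}}"
        using card empty by (auto simp: order_complex_def)
      then show ?thesis
        using mob rank True less by (simp add: wedge_of_spheres_negative n_def)
    next
      case False
      \<comment> \<open>A chain of \<open>n\<close> elements spans a simplex of dimension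
        \<open>n - 1\<close>, which is the difference of the ranks minus 2.\<close>
      then have "nat (int (wt w) - int (wt u) - 2) = n - 1" "0 \<le> int (wt w) - int (wt u) - 2"
        by (auto simp: n_def)
      moreover have "geometric_realization ?K homotopy_equivalent_space
          wedge {..<nat \<bar>\<Sum>C\<in>?K. (-1) ^ card C\<bar>} (\<lambda>_. nsphere (n - 1)) (\<lambda>_. sphere_basepoint)"
        using False empty card by (intro morse_homotopy_equivalent_wedge[OF morse]) auto
      ultimately show ?thesis
        unfolding rank mob wedge_of_spheres_def by simp
    qed
  qed
qed

end
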